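(* Let $T$ be an ergodic automorphism of a standard probability space $(X,\mu)$, and let $h_\mu(T)$ denote its Kolmogorov (Kolmogorov--Sinai) entropy. Then: 1) if $h_\mu(T)$ is finite and positive, then the sequence $h_n=n$ is a scaling entropy sequence of the system $(X,\mu,T)$; 2) if $\{h_n\}$ is a scaling entropy sequence of the system $(X,\mu,T)$, then $h_\mu(T)=0$ if and only if $h_n=o(n)$ as $n\to+\infty$.
   Context: A standard probability space is a Lebesgue--Rokhlin space; its measure may have atoms. An automorphism is an invertible (mod 0) measure-preserving transformation. A semimetric $\rho$ on $X$ is a nonnegative symmetric function on $X\times X$ that vanishes on the diagonal and satisfies the triangle inequality (distinct points may be at distance $0$). It is measurable if it is measurable on $(X^2,\mu^2)$ as a function of two variables. A measurable semimetric is admissible if there is a subset $X_1\subset X$ of full measure such that the semimetric space $(X_1,\rho)$ is separable. It is summable if $\int_{X\times X}\rho\,d(\mu\times\mu)<\infty$. Epsilon-entropy: for $\varepsilon>0$ let $k\in\mathbb{N}=\{1,2,\dots\}$ be the least number such that $X$ can be partitioned into disjoint measurable sets $X_0,X_1,\dots,X_k$ with $\mu(X_0)<\varepsilon$ and with the $\rho$-diameter of $X_j$ less than $\varepsilon$ for each $j=1,\dots,k$. Put $\mathbb{H}_\varepsilon(X,\mu,\rho)=\log_2 k$, and $\mathbb{H}_\varepsilon(X,\mu,\rho)=+\infty$ if no such $k$ exists. For $k\in\mathbb{Z}$ put $T^k\rho(x,y)=\rho(T^kx,T^ky)$, and for $n\ge 1$ put $T^n_{av}\rho=\frac1n\sum_{k=0}^{n-1}T^k\rho$.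 A measurable semimetric $\rho$ is (two-sided) generating for $(X,\mu,T)$ if there is a measurable set $X'\subset X$ of full measure such that for any two distinct $x,y\in X'$ there exists $k\in\mathbb{Z}$ with $T^k\rho(x,y)>0$. For an admissible semimetric $\rho$, a sequence $\{h_n\}$ of positive numbers is a scaling sequence for $\rho$ if for every $\varepsilon>0$ one has $\limsup_n \mathbb{H}_\varepsilon(X,\mu,T^n_{av}\rho)/h_n<+\infty$, and for all sufficiently small $\varepsilon>0$ one has $\liminf_n \mathbb{H}_\varepsilon(X,\mu,T^n_{av}\rho)/h_n>0$. A sequence of positive numbers is a scaling entropy sequence of $(X,\mu,T)$ if it is a scaling sequence for some (and then for any) summable admissible generating semimetric $\rho$ on $(X,\mu)$. *)

theory Defs
  imports "HOL-Probability.Probability" "HOL-Library.Landau_Symbols"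
begin

definition full_measure :: "'a measure \<Rightarrow> 'a set \<Rightarrow> bool" where
  "full_measure M A \<longleftrightarrow> A \<in> sets M \<and> (AE x in M. x \<in> A)"

definition isomorphic_mod0 :: "'a measure \<Rightarrow> 'b measure \<Rightarrow> bool" where
  "isomorphic_mod0 M N \<longleftrightarrow>
     (\<exists>A B f. full_measure M A \<and> full_measure N B \<and> bij_betw f A B \<and>
        f \<in> measurable (restrict_space M A) (restrict_space N B) \<and>
        the_inv_into A f \<in> measurable (restrict_space N B) (restrict_space M A) \<and>
        (\<forall>E\<in>sets M. E \<subseteq> A \<longrightarrow> emeasure N (f ` E) = emeasure M E))"

text \<open>
  The model Lebesgue--Rokhlin space: the interval \<open>[0, c]\<close> with Lebesgue measure, together
  with countably many atoms.  The atom of weight \<open>p n\<close> is placed at the point \<open>- (n + 1)\<close>, so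
  that the atoms lie off the interval.  The weight \<open>p n\<close> may be \<open>0\<close>, and \<open>c\<close> may be \<open>0\<close>.
\<close>

definition lebesgue_atoms_space :: "real \<Rightarrow> real set" where
  "lebesgue_atoms_space c = {0..c} \<union> range (\<lambda>n::nat. - real (Suc n))"

definition lebesgue_atoms :: "real \<Rightarrow> (nat \<Rightarrow> ennreal) \<Rightarrow> real measure" where
  "lebesgue_atoms c p =
     measure_of (lebesgue_atoms_space c) (sets (lebesgue_on (lebesgue_atoms_space c)))
       (\<lambda>A. emeasure lebesgue A + (\<Sum>n. p n * indicator A (- real (Suc n))))"

lemma lebesgue_atoms_space_sets: "lebesgue_atoms_space c \<in> sets lebesgue"
proof -
  have "range (\<lambda>n::nat. - real (Suc n)) \<in> sets lebesgue"
    by (intro sets_completionI_sets) (simp add: sets.countable)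
  then show ?thesis
    unfolding lebesgue_atoms_space_def by auto
qed

lemma space_lebesgue_atoms [simp]: "space (lebesgue_atoms c p) = lebesgue_atoms_space c"
  using sets.space_closed[of "lebesgue_on (lebesgue_atoms_space c)"]
  by (simp add: lebesgue_atoms_def space_measure_of)

lemma sets_lebesgue_atoms [simp]:
  "sets (lebesgue_atoms c p) = sets (lebesgue_on (lebesgue_atoms_space c))"
  using sets.sigma_sets_eq[of "lebesgue_on (lebesgue_atoms_space c)"]
    sets.space_closed[of "lebesgue_on (lebesgue_atoms_space c)"]
  by (simp add: lebesgue_atoms_def sets_measure_of)

lemma emeasure_lebesgue_atoms:
  assumes "A \<in> sets (lebesgue_on (lebesgue_atoms_space c))"
  shows "emeasure (lebesgue_atoms c p) A =
    emeasure lebesgue A + (\<Sum>n. p n * indicator A (- real (Suc n)))"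
proof (rule emeasure_measure_of[OF lebesgue_atoms_def])
  let ?R = "lebesgue_on (lebesgue_atoms_space c)"
  show "sets ?R \<subseteq> Pow (lebesgue_atoms_space c)"
    using sets.space_closed[of ?R] by simp
  show "positive (sets (lebesgue_atoms c p))
      (\<lambda>A. emeasure lebesgue A + (\<Sum>n. p n * indicator A (- real (Suc n))))"
    by (simp add: positive_def)
  show "A \<in> sets (lebesgue_atoms c p)"
    using assms by simp
  show "countably_additive (sets (lebesgue_atoms c p))
      (\<lambda>A. emeasure lebesgue A + (\<Sum>n. p n * indicator A (- real (Suc n))))"
  proof (rule countably_additiveI)
    fix F :: "nat \<Rightarrow> real set"
    assume F: "range F \<subseteq> sets (lebesgue_atoms c p)" "disjoint_family F"
    have "range F \<subseteq> sets lebesgue"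
      using F(1) lebesgue_atoms_space_sets[of c] by (auto simp: sets_restrict_space)
    then have L: "(\<Sum>i. emeasure lebesgue (F i)) = emeasure lebesgue (\<Union>i. F i)"
      using F(2) by (rule suminf_emeasure)
    have "(\<Sum>i. \<Sum>n. p n * indicator (F i) (- real (Suc n))) =
        (\<Sum>n. \<Sum>i. p n * indicator (F i) (- real (Suc n)))"
      by (simp only: nn_integral_count_space_nat[symmetric])
         (rule pair_sigma_finite.Fubini', auto simp: pair_sigma_finite_def
            intro: sigma_finite_measure_count_space measurable_pair_measure_countable1)
    also have "\<dots> = (\<Sum>n. p n * indicator (\<Union>i. F i) (- real (Suc n)))"
      using F(2) by (simp only: ennreal_suminf_cmult suminf_indicator)
    finally have P: "(\<Sum>i. \<Sum>n. p n * indicator (F i) (- real (Suc n))) =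
        (\<Sum>n. p n * indicator (\<Union>i. F i) (- real (Suc n)) :: ennreal)" .
    show "(\<Sum>i. emeasure lebesgue (F i) + (\<Sum>n. p n * indicator (F i) (- real (Suc n)))) =
        emeasure lebesgue (\<Union>i. F i) + (\<Sum>n. p n * indicator (\<Union>i. F i) (- real (Suc n)))"
      using L P by (simp add: suminf_add[symmetric])
  qed
qed

definition standard_probability_space :: "'a measure \<Rightarrow> bool" where
  "standard_probability_space M \<longleftrightarrow>
     prob_space M \<and> complete_measure M \<and> (\<exists>c p. isomorphic_mod0 M (lebesgue_atoms c p))"

text \<open>
  A transformation defined almost everywhere is extended to a map of the whole space into itself;
  completeness of the measure keeps the extension measurable.
\<close>

definition measure_preserving_map :: "'a measure \<Rightarrow> ('a \<Rightarrow> 'a) \<Rightarrow> bool" where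
  "measure_preserving_map M T \<longleftrightarrow> T \<in> measurable M M \<and> distr M M T = M"

definition inverse_mod0 :: "'a measure \<Rightarrow> ('a \<Rightarrow> 'a) \<Rightarrow> ('a \<Rightarrow> 'a) \<Rightarrow> bool" where
  "inverse_mod0 M T S \<longleftrightarrow>
     measure_preserving_map M S \<and> (AE x in M. S (T x) = x) \<and> (AE x in M. T (S x) = x)"

definition automorphism :: "'a measure \<Rightarrow> ('a \<Rightarrow> 'a) \<Rightarrow> bool" where
  "automorphism M T \<longleftrightarrow> measure_preserving_map M T \<and> (\<exists>S. inverse_mod0 M T S)"

text \<open>
  Integer powers.  The inverse is only determined up to a null set, so for negative \<open>k\<close> the
  power is determined almost everywhere; the notions below do not depend on the choice.
\<close>

definition aut_power :: "'a measure \<Rightarrow> ('a \<Rightarrow> 'a) \<Rightarrow> int \<Rightarrow> 'a \<Rightarrow> 'a" where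
  "aut_power M T k =
     (if 0 \<le> k then T ^^ nat k else (SOME S. inverse_mod0 M T S) ^^ nat (- k))"

definition ergodic :: "'a measure \<Rightarrow> ('a \<Rightarrow> 'a) \<Rightarrow> bool" where
  "ergodic M T \<longleftrightarrow>
     (\<forall>A\<in>sets M. T -` A \<inter> space M = A \<longrightarrow> measure M A = 0 \<or> measure M A = 1)"

definition finite_measurable_partition :: "'a measure \<Rightarrow> 'a set set \<Rightarrow> bool" where
  "finite_measurable_partition M \<xi> \<longleftrightarrow>
     finite \<xi> \<and> \<xi> \<subseteq> sets M \<and> partition_on (space M) \<xi>"

definition partition_entropy :: "'a measure \<Rightarrow> 'a set set \<Rightarrow> real" where
  "partition_entropy M \<xi> = - (\<Sum>A\<in>\<xi>. measure M A * log 2 (measure M A))"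

definition iterated_join :: "'a measure \<Rightarrow> ('a \<Rightarrow> 'a) \<Rightarrow> 'a set set \<Rightarrow> nat \<Rightarrow> 'a set set" where
  "iterated_join M T \<xi> n =
     {space M \<inter> (\<Inter>k<n. (T ^^ k) -` A k) | A. \<forall>k<n. A k \<in> \<xi>} - {{}}"

definition ks_entropy_partition :: "'a measure \<Rightarrow> ('a \<Rightarrow> 'a) \<Rightarrow> 'a set set \<Rightarrow> real" where
  "ks_entropy_partition M T \<xi> =
     lim (\<lambda>n. partition_entropy M (iterated_join M T \<xi> n) / real n)"

definition ks_entropy :: "'a measure \<Rightarrow> ('a \<Rightarrow> 'a) \<Rightarrow> ereal" where
  "ks_entropy M T =
     (SUP \<xi> \<in> {\<xi>. finite_measurable_partition M \<xi>}. ereal (ks_entropy_partition M T \<xi>))"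

definition semimetric_on :: "'a set \<Rightarrow> ('a \<Rightarrow> 'a \<Rightarrow> real) \<Rightarrow> bool" where
  "semimetric_on X \<rho> \<longleftrightarrow>
     (\<forall>x\<in>X. \<forall>y\<in>X. 0 \<le> \<rho> x y \<and> \<rho> x y = \<rho> y x) \<and>
     (\<forall>x\<in>X. \<rho> x x = 0) \<and>
     (\<forall>x\<in>X. \<forall>y\<in>X. \<forall>z\<in>X. \<rho> x z \<le> \<rho> x y + \<rho> y z)"

text \<open>The square of a Lebesgue--Rokhlin space carries the completed product measure.\<close>

definition measurable_semimetric :: "'a measure \<Rightarrow> ('a \<Rightarrow> 'a \<Rightarrow> real) \<Rightarrow> bool" where
  "measurable_semimetric M \<rho> \<longleftrightarrow>
     semimetric_on (space M) \<rho> \<and>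
     (\<lambda>(x, y). \<rho> x y) \<in> borel_measurable (completion (M \<Otimes>\<^sub>M M))"

definition semimetric_separable :: "'a set \<Rightarrow> ('a \<Rightarrow> 'a \<Rightarrow> real) \<Rightarrow> bool" where
  "semimetric_separable X \<rho> \<longleftrightarrow>
     (\<exists>D. countable D \<and> D \<subseteq> X \<and> (\<forall>x\<in>X. \<forall>e>0. \<exists>d\<in>D. \<rho> x d < e))"

definition admissible :: "'a measure \<Rightarrow> ('a \<Rightarrow> 'a \<Rightarrow> real) \<Rightarrow> bool" where
  "admissible M \<rho> \<longleftrightarrow>
     measurable_semimetric M \<rho> \<and> (\<exists>X1. full_measure M X1 \<and> semimetric_separable X1 \<rho>)"

definition summable_semimetric :: "'a measure \<Rightarrow> ('a \<Rightarrow> 'a \<Rightarrow> real) \<Rightarrow> bool" where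
  "summable_semimetric M \<rho> \<longleftrightarrow> integrable (completion (M \<Otimes>\<^sub>M M)) (\<lambda>(x, y). \<rho> x y)"

definition semimetric_diameter :: "('a \<Rightarrow> 'a \<Rightarrow> real) \<Rightarrow> 'a set \<Rightarrow> ennreal" where
  "semimetric_diameter \<rho> A = (SUP x\<in>A. SUP y\<in>A. ennreal (\<rho> x y))"

definition eps_partitionable :: "'a measure \<Rightarrow> ('a \<Rightarrow> 'a \<Rightarrow> real) \<Rightarrow> real \<Rightarrow> nat \<Rightarrow> bool" where
  "eps_partitionable M \<rho> \<epsilon> k \<longleftrightarrow>
     (\<exists>X :: nat \<Rightarrow> 'a set.
        (\<forall>j\<le>k. X j \<in> sets M) \<and> disjoint_family_on X {..k} \<and> (\<Union>j\<le>k. X j) = space M \<and>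
        measure M (X 0) < \<epsilon> \<and>
        (\<forall>j\<in>{1..k}. semimetric_diameter \<rho> (X j) < ennreal \<epsilon>))"

definition eps_entropy :: "'a measure \<Rightarrow> ('a \<Rightarrow> 'a \<Rightarrow> real) \<Rightarrow> real \<Rightarrow> ereal" where
  "eps_entropy M \<rho> \<epsilon> =
     (if \<exists>k\<ge>1. eps_partitionable M \<rho> \<epsilon> k
      then ereal (log 2 (real (LEAST k. 1 \<le> k \<and> eps_partitionable M \<rho> \<epsilon> k)))
      else \<infinity>)"

definition translate :: "'a measure \<Rightarrow> ('a \<Rightarrow> 'a) \<Rightarrow> int \<Rightarrow> ('a \<Rightarrow> 'a \<Rightarrow> real) \<Rightarrow> 'a \<Rightarrow> 'a \<Rightarrow> real" where
  "translate M T k \<rho> x y = \<rho> (aut_power M T k x) (aut_power M T k y)"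

definition average :: "'a measure \<Rightarrow> ('a \<Rightarrow> 'a) \<Rightarrow> nat \<Rightarrow> ('a \<Rightarrow> 'a \<Rightarrow> real) \<Rightarrow> 'a \<Rightarrow> 'a \<Rightarrow> real" where
  "average M T n \<rho> x y = (\<Sum>k<n. translate M T (int k) \<rho> x y) / real n"

definition generating :: "'a measure \<Rightarrow> ('a \<Rightarrow> 'a) \<Rightarrow> ('a \<Rightarrow> 'a \<Rightarrow> real) \<Rightarrow> bool" where
  "generating M T \<rho> \<longleftrightarrow>
     (\<exists>X'. full_measure M X' \<and>
        (\<forall>x\<in>X'. \<forall>y\<in>X'. x \<noteq> y \<longrightarrow> (\<exists>k::int. translate M T k \<rho> x y > 0)))"

text \<open>Sequences are indexed by \<open>n \<ge> 1\<close>; the value at \<open>0\<close> is irrelevant.\<close>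

definition scaling_sequence ::
    "'a measure \<Rightarrow> ('a \<Rightarrow> 'a) \<Rightarrow> ('a \<Rightarrow> 'a \<Rightarrow> real) \<Rightarrow> (nat \<Rightarrow> real) \<Rightarrow> bool" where
  "scaling_sequence M T \<rho> h \<longleftrightarrow>
     (\<forall>n\<ge>1. 0 < h n) \<and>
     (\<forall>\<epsilon>>0. limsup (\<lambda>n. eps_entropy M (average M T n \<rho>) \<epsilon> / ereal (h n)) < \<infinity>) \<and>
     (\<forall>\<^sub>F \<epsilon> in at_right 0.
        0 < liminf (\<lambda>n. eps_entropy M (average M T n \<rho>) \<epsilon> / ereal (h n)))"

definition scaling_entropy_sequence ::
    "'a measure \<Rightarrow> ('a \<Rightarrow> 'a) \<Rightarrow> (nat \<Rightarrow> real) \<Rightarrow> bool" where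
  "scaling_entropy_sequence M T h \<longleftrightarrow>
     (\<exists>\<rho>. admissible M \<rho> \<and> summable_semimetric M \<rho> \<and> generating M T \<rho> \<and>
        scaling_sequence M T \<rho> h)"

end

theory Submission
  imports Defs
begin

text \<open>
  Both parts compare the epsilon-entropy of an averaged semimetric with the entropies \<open>H n\<close> of the
  joins of a finite partition, where \<open>H n / n\<close> converges by Fekete's lemma.

  From above: an admissible summable semimetric is uniformly small on the classes of a suitable
  finite partition, up to an error \<open>b x + b y\<close> with small integral.  By Markov's inequality the
  averages of \<open>b\<close> along orbits are small off a small set, and all but a small part of the space is
  covered by about \<open>2 powr (C * H n)\<close> cylinders.

  From below: on a standard space the countably many functions
  \<open>x \<mapsto> \<rho> (d i) (T\<^sup>k x)\<close>, with \<open>d\<close> dense and \<open>\<rho>\<close> generating, separate points.  By compactness,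
  finitely many of them separate the classes of a given partition with a uniform gap on a large set,
  so a small averaged distance forces a small Hamming distance of names.  A cover by few sets of
  small diameter therefore gives a cover of the names by few Hamming balls, which bounds \<open>H n\<close>.
\<close>

section \<open>Entropy of iterated joins\<close>

text \<open>Generation is two-sided, while the averages look only forward in time. Separation found
  in a window \<open>[-m, m]\<close> is therefore read around the interior positions of a forward
  orbit segment, which costs \<open>m\<close> letters at each end of a name, and negative powers are
  cancelled on a forward invariant set where the inverse is genuine. The space has no topology of
  its own: compactness is imported from the real line through the isomorphism with the model, and
  every set involved is made relatively clopen on a compact set before a finite subcover is taken.
  Only the linear order of growth matters, so crude estimates suffice: Markov's inequality for minus
  the logarithm of the cylinder probability stands in for an equipartition theorem in the upper
  bound. There the partition depends on the precision; in the lower bound it is fixed in advance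
  with a positive limit of \<open>H n / n\<close>, so the linear rate is the same for all small
  precisions.\<close>

lemma subadditive_tendsto_Inf:
  fixes a :: "nat \<Rightarrow> real"
  assumes nonneg: "\<And>n. 0 \<le> a n" and sub: "\<And>m n. a (m + n) \<le> a m + a n"
  shows "(\<lambda>n. a n / real n) \<longlonglongrightarrow> (INF n\<in>{1..}. a n / real n)"
proof -
  define L where "L = (INF n\<in>{1..}. a n / real n)"
  have bdd: "bdd_below ((\<lambda>n. a n / real n) ` {1..})"
    by (rule bdd_belowI[of _ 0]) (auto simp: nonneg)
  have lower: "L \<le> a n / real n" if "n \<ge> 1" for n
    unfolding L_def using bdd that by (intro cINF_lower) auto
  have mult: "a (q * m + r) \<le> real q * a m + a r" for q m r
  proof (induction q)
    case (Suc q)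
    have "a (Suc q * m + r) = a (m + (q * m + r))" by (simp add: algebra_simps)
    also have "\<dots> \<le> a m + a (q * m + r)" by (rule sub)
    also have "\<dots> \<le> real (Suc q) * a m + a r" using Suc by (simp add: algebra_simps)
    finally show ?case .
  qed simp
  have "(\<lambda>n. a n / real n) \<longlonglongrightarrow> L"
  proof (rule LIMSEQ_I)
    fix e :: real assume e: "0 < e"
    \<comment> \<open>A block length whose ratio is within \<open>e / 2\<close> of the infimum. The
      other \<open>e / 2\<close> absorbs the remainder of a division by \<open>m\<close>, which
      \<open>C\<close> bounds independently of \<open>n\<close>.\<close>
    obtain m where m: "m \<ge> 1" "a m / real m < L + e / 2"
    proof -
      have "L < L + e / 2" using e by simp
      then have "\<exists>i\<in>{1..}. a i / real i < L + e / 2"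
        unfolding L_def using bdd by (subst (asm) cINF_less_iff) auto
      then show ?thesis using that by auto
    qed
    define C where "C = (\<Sum>r<m. a r)"
    have C: "a (n mod m) \<le> C" for n
      unfolding C_def using m nonneg by (intro member_le_sum) auto
    obtain n0 :: nat where n0: "C / (e / 2) < real n0" using reals_Archimedean2 by blast
    show "\<exists>no. \<forall>n\<ge>no. norm (a n / real n - L) < e"
    proof (intro exI allI impI)
      fix n assume n: "max 1 n0 \<le> n"
      have "a n \<le> real (n div m) * a m + a (n mod m)"
        using mult[of "n div m" m "n mod m"] by simp
      also have "\<dots> \<le> (real n / real m) * a m + C"
        using C[of n] nonneg[of m] of_nat_div_le_of_nat[of n m, where 'a = real]
        by (intro add_mono mult_right_mono) auto
      finally have "a n / real n \<le> ((real n / real m) * a m + C) / real n"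
        by (rule divide_right_mono) simp
      also have "\<dots> = a m / real m + C / real n"
        using n m by (simp add: field_simps)
      also have "C / real n < e / 2"
        using n0 n e by (simp add: field_simps) (smt (verit) mult_left_mono of_nat_le_iff)
      finally have "a n / real n < L + e" using m by simp
      moreover have "L \<le> a n / real n" using n by (intro lower) auto
      ultimately show "norm (a n / real n - L) < e" by simp
    qed
  qed
  then show ?thesis by (simp add: L_def)
qed

text \<open>The bound \<open>ln z \<le> z - 1\<close> at \<open>z = q v / p v\<close>, summed over
  \<open>v\<close>. The total of \<open>q\<close> may be smaller than that of \<open>p\<close>, so a
  distribution on all words can be restricted to the names that occur; positivity of
  \<open>q\<close> keeps its logarithm meaningful.\<close>

lemma gibbs_inequality:
  fixes p q :: "'b \<Rightarrow> real"
  assumes "finite V" and p: "\<And>v. v \<in> V \<Longrightarrow> 0 \<le> p v" and q: "\<And>v. v \<in> V \<Longrightarrow> 0 < q v"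
    and le: "(\<Sum>v\<in>V. q v) \<le> (\<Sum>v\<in>V. p v)"
  shows "- (\<Sum>v\<in>V. p v * log 2 (p v)) \<le> - (\<Sum>v\<in>V. p v * log 2 (q v))"
proof -
  have "p v * ln (q v) - p v * ln (p v) \<le> q v - p v" if v: "v \<in> V" for v
  proof (cases "p v = 0")
    case False
    then have pos: "0 < p v" using p[OF v] by simp
    then have "ln (q v) - ln (p v) = ln (q v / p v)"
      using q[OF v] by (simp add: ln_div)
    also have "\<dots> \<le> q v / p v - 1"
      using q[OF v] pos by (intro ln_le_minus_one) simp
    finally have "p v * (ln (q v) - ln (p v)) \<le> p v * (q v / p v - 1)"
      using pos by (intro mult_left_mono) auto
    then show ?thesis using pos by (simp add: algebra_simps)
  qed (use q[OF v] in auto)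
  then have "(\<Sum>v\<in>V. p v * ln (q v) - p v * ln (p v)) \<le> (\<Sum>v\<in>V. q v - p v)"
    by (rule sum_mono)
  then have "(\<Sum>v\<in>V. p v * ln (q v)) \<le> (\<Sum>v\<in>V. p v * ln (p v))"
    using le by (simp add: sum_subtractf)
  then have "(\<Sum>v\<in>V. p v * ln (q v)) / ln 2 \<le> (\<Sum>v\<in>V. p v * ln (p v)) / ln 2"
    by (intro divide_right_mono) auto
  then show ?thesis by (simp add: log_def sum_divide_distrib)
qed

text \<open>Entropy sees only the partition into level sets. The recoding \<open>g\<close> with
  \<open>X = g \<circ> Y\<close> on the space is built from chosen representatives and is injective
  on the range of \<open>Y\<close>.\<close>

lemma (in information_space) entropy_inj_image:
  assumes X: "simple_function M X" and Y: "simple_function M Y"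
    and eq: "\<And>x y. x \<in> space M \<Longrightarrow> y \<in> space M \<Longrightarrow> X x = X y \<longleftrightarrow> Y x = Y y"
  shows "\<H>(X) = \<H>(Y)"
proof -
  define g where "g y = X (SOME x. x \<in> space M \<and> Y x = y)" for y
  have g: "X x = g (Y x)" if x: "x \<in> space M" for x
  proof -
    have "(SOME x'. x' \<in> space M \<and> Y x' = Y x) \<in> space M \<and> Y (SOME x'. x' \<in> space M \<and> Y x' = Y x) = Y x"
      by (rule someI[of _ x]) (use x in auto)
    then show ?thesis unfolding g_def using eq x by auto
  qed
  have inj: "inj_on g (Y ` space M)"
  proof (rule inj_onI)
    fix a b assume "a \<in> Y ` space M" "b \<in> Y ` space M" and ab: "g a = g b"
    then obtain x y where "x \<in> space M" "a = Y x" "y \<in> space M" "b = Y y" by auto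
    then show "a = b" using eq g ab by metis
  qed
  have img: "X ` space M = g ` Y ` space M" using g by force
  have cell: "X -` {g y} \<inter> space M = Y -` {y} \<inter> space M" if y: "y \<in> Y ` space M" for y
  proof -
    obtain x where "x \<in> space M" "y = Y x" using y by auto
    then show ?thesis using g[of x] eq[of _ x] by auto
  qed
  have "\<H>(X) = - (\<Sum>x\<in>X ` space M. prob (X -` {x} \<inter> space M) * log b (prob (X -` {x} \<inter> space M)))"
    by (rule entropy_simple_distributed, rule simple_distributedI[OF X]) auto
  also have "\<dots> = - (\<Sum>y\<in>Y ` space M. prob (Y -` {y} \<inter> space M) * log b (prob (Y -` {y} \<inter> space M)))"
    unfolding img by (subst sum.reindex[OF inj]) (auto simp: cell)
  also have "\<dots> = \<H>(Y)"
    by (rule entropy_simple_distributed[symmetric], rule simple_distributedI[OF Y]) auto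
  finally show ?thesis .
qed

lemma (in information_space) entropy_pair_le:
  assumes X: "simple_function M X" and Y: "simple_function M Y"
  shows "\<H>(\<lambda>x. (X x, Y x)) \<le> \<H>(X) + \<H>(Y)"
  using entropy_chain_rule[OF X Y] conditional_entropy_less_eq_entropy[OF Y X] by simp

section \<open>Names and cylinders of a finite partition\<close>

definition class_of :: "'a set set \<Rightarrow> 'a \<Rightarrow> 'a set" where
  "class_of \<xi> x = (THE A. A \<in> \<xi> \<and> x \<in> A)"

text \<open>Restricting to \<open>{..<n}\<close> makes names extensional: equality of functions is
  equality of the first \<open>n\<close> letters, and the names lie in a finite set of
  words.\<close>

definition name :: "('a \<Rightarrow> 'a) \<Rightarrow> 'a set set \<Rightarrow> nat \<Rightarrow> 'a \<Rightarrow> nat \<Rightarrow> 'a set" where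
  "name T \<xi> n x = restrict (\<lambda>k. class_of \<xi> ((T ^^ k) x)) {..<n}"

definition cylinder :: "'a measure \<Rightarrow> ('a \<Rightarrow> 'a) \<Rightarrow> 'a set set \<Rightarrow> nat \<Rightarrow> (nat \<Rightarrow> 'a set) \<Rightarrow> 'a set" where
  "cylinder M T \<xi> n v = {x \<in> space M. name T \<xi> n x = v}"

lemma class_of_unique:
  assumes "partition_on X \<xi>" "A \<in> \<xi>" "x \<in> A"
  shows "class_of \<xi> x = A"
  unfolding class_of_def
proof (rule the_equality)
  fix B assume "B \<in> \<xi> \<and> x \<in> B"
  then show "B = A" using assms unfolding partition_on_def disjoint_def by blast
qed (use assms in auto)

lemma class_of_in:
  assumes "partition_on X \<xi>" "x \<in> X"
  shows "class_of \<xi> x \<in> \<xi>" "x \<in> class_of \<xi> x"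
proof -
  obtain A where "A \<in> \<xi>" "x \<in> A" using assms unfolding partition_on_def by blast
  then show "class_of \<xi> x \<in> \<xi>" "x \<in> class_of \<xi> x"
    using class_of_unique[OF assms(1)] by auto
qed

locale mps = prob_space M for M :: "'a measure" +
  fixes T :: "'a \<Rightarrow> 'a"
  assumes T_meas [measurable]: "T \<in> measurable M M"
    and T_distr: "distr M M T = M"
begin

lemma iter_meas [measurable]: "(T ^^ k) \<in> measurable M M"
  by (induction k) auto

lemma iter_in_space: "x \<in> space M \<Longrightarrow> (T ^^ k) x \<in> space M"
  using measurable_space[OF iter_meas] .

lemma iter_distr: "distr M M (T ^^ k) = M"
proof (induction k)
  case 0
  then show ?case by (simp add: distr_id2)
next
  case (Suc k)
  have "distr M M (T ^^ Suc k) = distr (distr M M (T ^^ k)) M T"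
    by (simp add: distr_distr)
  then show ?case using Suc T_distr by (simp del: funpow.simps)
qed

lemma prob_iter_vimage:
  assumes "A \<in> sets M"
  shows "prob ((T ^^ k) -` A \<inter> space M) = prob A"
  using measure_distr[OF iter_meas assms, of k] iter_distr by simp

lemma AE_iter:
  assumes "AE x in M. P x"
  shows "AE x in M. \<forall>k. P ((T ^^ k) x)"
proof -
  have "AE x in M. P ((T ^^ k) x)" for k
  proof -
    have "AE x in distr M M (T ^^ k). P x" using assms by (simp only: iter_distr)
    then show ?thesis by (rule AE_distrD[OF iter_meas])
  qed
  then show ?thesis by (simp add: AE_all_countable)
qed

end

locale mps_partition = mps M T for M :: "'a measure" and T +
  fixes \<xi> :: "'a set set"
  assumes part: "finite_measurable_partition M \<xi>"
begin

lemma fin: "finite \<xi>" and sets_part: "A \<in> \<xi> \<Longrightarrow> A \<in> sets M" and pon: "partition_on (space M) \<xi>"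
  using part by (auto simp: finite_measurable_partition_def)

lemma class_in: "x \<in> space M \<Longrightarrow> class_of \<xi> ((T ^^ k) x) \<in> \<xi>"
  by (intro class_of_in[OF pon] iter_in_space)

lemma part_nonempty: "\<xi> \<noteq> {}"
  using not_empty class_of_in(1)[OF pon] by blast

lemma name_in_words: "x \<in> space M \<Longrightarrow> name T \<xi> n x \<in> {..<n} \<rightarrow>\<^sub>E \<xi>"
  unfolding name_def by (intro restrict_PiE_iff[THEN iffD2] ballI class_in)

lemma finite_words: "finite ({..<n::nat} \<rightarrow>\<^sub>E \<xi>)"
  by (intro finite_PiE finite_lessThan fin)

lemma finite_names: "finite (name T \<xi> n ` space M)"
  by (rule finite_subset[OF _ finite_words]) (use name_in_words in blast)

lemma cylinder_eq:
  assumes "v \<in> {..<n} \<rightarrow>\<^sub>E \<xi>"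
  shows "cylinder M T \<xi> n v = space M \<inter> (\<Inter>k<n. (T ^^ k) -` v k)"
proof (intro set_eqI iffI)
  fix x assume x: "x \<in> cylinder M T \<xi> n v"
  then have sp: "x \<in> space M" and v: "v = name T \<xi> n x"
    by (auto simp: cylinder_def)
  have "(T ^^ k) x \<in> v k" if "k < n" for k
    using that class_of_in(2)[OF pon iter_in_space[OF sp, of k]] by (simp add: v name_def)
  then show "x \<in> space M \<inter> (\<Inter>k<n. (T ^^ k) -` v k)"
    using sp by blast
next
  fix x assume x: "x \<in> space M \<inter> (\<Inter>k<n. (T ^^ k) -` v k)"
  have "class_of \<xi> ((T ^^ k) x) = v k" if k: "k < n" for k
  proof (rule class_of_unique[OF pon])
    show "v k \<in> \<xi>" using PiE_mem[OF assms] k by simp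
    show "(T ^^ k) x \<in> v k" using x k by blast
  qed
  then have "name T \<xi> n x k = v k" for k
    using PiE_arb[OF assms, of k] by (cases "k < n") (auto simp: name_def)
  then have "name T \<xi> n x = v" by (rule ext)
  then show "x \<in> cylinder M T \<xi> n v" using x by (simp add: cylinder_def)
qed

lemma cylinder_sets [measurable]: "cylinder M T \<xi> n v \<in> sets M"
proof (cases "v \<in> {..<n} \<rightarrow>\<^sub>E \<xi>")
  case True
  have *: "(T ^^ k) -` v k \<inter> space M \<in> sets M" if "k < n" for k
    using True that by (intro measurable_sets[OF iter_meas] sets_part) auto
  have "cylinder M T \<xi> n v = {x \<in> space M. \<forall>k\<in>{..<n}. x \<in> (T ^^ k) -` v k \<inter> space M}"
    using cylinder_eq[OF True] by auto
  also have "\<dots> \<in> sets M"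
  proof (intro sets.sets_Collect_finite_All finite_lessThan)
    fix k assume "k \<in> {..<n}"
    moreover have "{x \<in> space M. x \<in> (T ^^ k) -` v k \<inter> space M} = (T ^^ k) -` v k \<inter> space M" by auto
    ultimately show "{x \<in> space M. x \<in> (T ^^ k) -` v k \<inter> space M} \<in> sets M" using * by simp
  qed
  finally show ?thesis .
next
  case False
  then have "cylinder M T \<xi> n v = {}" using name_in_words by (auto simp: cylinder_def)
  then show ?thesis by simp
qed

lemma name_vimage: "name T \<xi> n -` {v} \<inter> space M = cylinder M T \<xi> n v"
  by (auto simp: cylinder_def)

lemma simple_function_name: "simple_function M (name T \<xi> n)"
  unfolding simple_function_def by (auto simp: finite_names, simp add: name_vimage)

text \<open>Discarding \<open>{}\<close> from the join discards exactly the words that are nobody's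
  name.\<close>

lemma iterated_join_eq: "iterated_join M T \<xi> n = cylinder M T \<xi> n ` name T \<xi> n ` space M"
proof (intro set_eqI iffI)
  fix B assume "B \<in> iterated_join M T \<xi> n"
  then obtain A where A: "\<forall>k<n. A k \<in> \<xi>" and B: "B = space M \<inter> (\<Inter>k<n. (T ^^ k) -` A k)" "B \<noteq> {}"
    by (auto simp: iterated_join_def)
  define v where "v = restrict A {..<n}"
  have v: "v \<in> {..<n} \<rightarrow>\<^sub>E \<xi>" using A by (auto simp: v_def)
  have "B = cylinder M T \<xi> n v" unfolding cylinder_eq[OF v] B by (auto simp: v_def)
  moreover obtain x where "x \<in> B" using B by auto
  ultimately show "B \<in> cylinder M T \<xi> n ` name T \<xi> n ` space M" by (auto simp: cylinder_def)
next
  fix B assume "B \<in> cylinder M T \<xi> n ` name T \<xi> n ` space M"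
  then obtain x where x: "x \<in> space M" and B: "B = cylinder M T \<xi> n (name T \<xi> n x)" by auto
  have "x \<in> B" using x B by (simp add: cylinder_def)
  then show "B \<in> iterated_join M T \<xi> n"
    unfolding B cylinder_eq[OF name_in_words[OF x]] iterated_join_def
    using name_in_words[OF x, of n] by (auto intro!: exI[of _ "name T \<xi> n x"])
qed

definition Hn :: "nat \<Rightarrow> real" where
  "Hn n = partition_entropy M (iterated_join M T \<xi> n)"

lemma Hn_eq: "Hn n = - (\<Sum>v\<in>name T \<xi> n ` space M.
    prob (cylinder M T \<xi> n v) * log 2 (prob (cylinder M T \<xi> n v)))"
proof -
  have "inj_on (cylinder M T \<xi> n) (name T \<xi> n ` space M)"
    by (rule inj_onI) (auto simp: cylinder_def set_eq_iff)
  then show ?thesis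
    unfolding Hn_def partition_entropy_def iterated_join_eq
    by (subst sum.reindex) (auto simp: comp_def)
qed

text \<open>Base 2 matches the logarithm in \<open>partition_entropy\<close>, so general facts on
  Shannon entropy apply to \<open>Hn\<close>.\<close>

sublocale information_space M 2
  by unfold_locales simp

end

section \<open>Subadditivity of the join entropies\<close>

context mps_partition
begin

abbreviation ent :: "('a \<Rightarrow> 'c) \<Rightarrow> real" where
  "ent X \<equiv> entropy 2 (count_space (X ` space M)) X"

lemma Hn_entropy: "Hn n = ent (name T \<xi> n)"
proof -
  have "simple_distributed M (name T \<xi> n) (\<lambda>v. prob (cylinder M T \<xi> n v))"
    by (rule simple_distributedI[OF simple_function_name]) (auto simp: name_vimage)
  from entropy_simple_distributed[OF this] show ?thesis by (simp add: Hn_eq)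
qed

lemma sum_prob_cylinder:
  assumes "V \<subseteq> name T \<xi> n ` space M"
  shows "(\<Sum>v\<in>V. prob (cylinder M T \<xi> n v)) = prob (\<Union>v\<in>V. cylinder M T \<xi> n v)"
  using finite_subset[OF assms finite_names]
  by (intro finite_measure_finite_Union[symmetric])
     (auto simp: disjoint_family_on_def cylinder_def image_subset_iff cylinder_sets[unfolded cylinder_def])

lemma sum_prob_names: "(\<Sum>v\<in>name T \<xi> n ` space M. prob (cylinder M T \<xi> n v)) = 1"
proof -
  have "(\<Union>v\<in>name T \<xi> n ` space M. cylinder M T \<xi> n v) = space M" by (auto simp: cylinder_def)
  then show ?thesis using sum_prob_cylinder[of "name T \<xi> n ` space M" n] by (simp add: prob_space)
qed

lemma Hn_nonneg: "0 \<le> Hn n"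
proof -
  have "prob (cylinder M T \<xi> n v) * log 2 (prob (cylinder M T \<xi> n v)) \<le> 0" for v
  proof (cases "prob (cylinder M T \<xi> n v) = 0")
    case False
    then have "0 < prob (cylinder M T \<xi> n v)" by (simp add: less_le)
    then show ?thesis
      using prob_le_1[of "cylinder M T \<xi> n v"] by (intro mult_nonneg_nonpos) auto
  qed simp
  then show ?thesis unfolding Hn_eq by (simp add: sum_nonpos)
qed

lemma name_add:
  "name T \<xi> (m + n) x = name T \<xi> (m + n) y \<longleftrightarrow>
    name T \<xi> n x = name T \<xi> n y \<and> name T \<xi> m ((T ^^ n) x) = name T \<xi> m ((T ^^ n) y)"
proof -
  have iff: "name T \<xi> k x = name T \<xi> k y \<longleftrightarrow>
      (\<forall>i<k. class_of \<xi> ((T ^^ i) x) = class_of \<xi> ((T ^^ i) y))" for k x y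
    by (auto simp: name_def fun_eq_iff)
  have "(\<forall>i<m+n. P i) \<longleftrightarrow> (\<forall>i<n. P i) \<and> (\<forall>i<m. P (i + n))" for P
  proof safe
    fix i assume "\<forall>i<n. P i" "\<forall>i<m. P (i + n)" "i < m + n"
    then show "P i" by (metis add_diff_inverse_nat add.commute less_diff_conv2 linorder_not_less)
  qed auto
  then show ?thesis unfolding iff by (simp add: funpow_add)
qed

text \<open>A name of length \<open>m + n\<close> carries the same information as its first
  \<open>n\<close> letters together with the \<open>m\<close>-name of \<open>(T ^^ n) x\<close>, and
  by invariance the second block has the distribution of an \<open>m\<close>-name.\<close>

lemma Hn_subadditive: "Hn (m + n) \<le> Hn m + Hn n"
proof -
  let ?X = "name T \<xi> n" and ?Y = "\<lambda>x. name T \<xi> m ((T ^^ n) x)"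
  have simp_comp: "simple_function M ?Y"
    using simple_function_comp[OF iter_meas, of "name T \<xi> m" n] simple_function_name by (simp add: comp_def)
  have pair: "simple_function M (\<lambda>x. (?X x, ?Y x))"
    by (intro simple_function_Pair simple_function_name simp_comp)
  have "Hn (m + n) = ent (\<lambda>x. (?X x, ?Y x))"
    unfolding Hn_entropy by (rule entropy_inj_image[OF simple_function_name pair]) (auto simp: name_add)
  also have "\<dots> \<le> ent (?X) + ent (?Y)"
    by (rule entropy_pair_le[OF simple_function_name simp_comp])
  \<comment> \<open>The two ranges may differ, since \<open>T ^^ n\<close> need not be onto; the
    words missing from the range of \<open>?Y\<close> have probability zero and contribute nothing
    to the sum.\<close>
  also have "ent (?Y) \<le> ent (name T \<xi> m)"
  proof -
    have p: "prob (?Y -` {v} \<inter> space M) = prob (cylinder M T \<xi> m v)" for v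
    proof -
      have "?Y -` {v} \<inter> space M = (T ^^ n) -` cylinder M T \<xi> m v \<inter> space M"
        using iter_in_space by (auto simp: cylinder_def)
      then show ?thesis by (simp add: prob_iter_vimage)
    qed
    have sub: "?Y ` space M \<subseteq> name T \<xi> m ` space M" using iter_in_space by auto
    have zero: "prob (cylinder M T \<xi> m v) = 0" if "v \<notin> ?Y ` space M" for v
    proof -
      have "?Y -` {v} \<inter> space M = {}" using that by auto
      then show ?thesis using p[of v] by simp
    qed
    have "ent (?Y) = - (\<Sum>v\<in>?Y ` space M. prob (cylinder M T \<xi> m v) * log 2 (prob (cylinder M T \<xi> m v)))"
      by (rule entropy_simple_distributed, rule simple_distributedI[OF simp_comp]) (auto simp: p)
    also have "\<dots> = Hn m" unfolding Hn_eq
      by (intro arg_cong[where f = uminus] sum.mono_neutral_left)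
         (use zero sub finite_names in auto)
    finally show ?thesis by (simp add: Hn_entropy)
  qed
  finally show ?thesis by (simp add: Hn_entropy)
qed

text \<open>Without convergence the \<open>lim\<close> in \<open>ks_entropy_partition\<close> would
  be an unspecified value; this gives it its meaning.\<close>

lemma Hn_tendsto: "(\<lambda>n. Hn n / real n) \<longlonglongrightarrow> ks_entropy_partition M T \<xi>"
proof -
  have conv: "(\<lambda>n. Hn n / real n) \<longlonglongrightarrow> (INF n\<in>{1..}. Hn n / real n)"
    by (intro subadditive_tendsto_Inf Hn_nonneg Hn_subadditive)
  then show ?thesis using limI[OF conv] by (simp add: ks_entropy_partition_def Hn_def)
qed

end

section \<open>Compactness in standard probability spaces\<close>

text \<open>Inner regularity of Lebesgue measure, transported by the isomorphism with the model,
  which serves as \<open>g\<close>. Compactness can be claimed only for images in the real line, and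
  \<open>g\<close> carries no continuity, so sets are compared through their images.\<close>

lemma standard_compact_approximation:
  fixes M :: "'a measure"
  assumes "standard_probability_space M"
  obtains g :: "'a \<Rightarrow> real" and A where
    "full_measure M A" "inj_on g A" "g \<in> borel_measurable (restrict_space M A)"
    "\<And>E \<delta>. E \<in> sets M \<Longrightarrow> E \<subseteq> A \<Longrightarrow> 0 < \<delta> \<Longrightarrow>
       \<exists>C. compact C \<and> C \<subseteq> g ` E \<and> measure M (E - g -` C) < \<delta>"
proof -
  interpret prob_space M using assms by (simp add: standard_probability_space_def)
  obtain c p where "isomorphic_mod0 M (lebesgue_atoms c p)"
    using assms by (auto simp: standard_probability_space_def)
  then obtain A B f where A: "full_measure M A" and B: "full_measure (lebesgue_atoms c p) B"
    and bij: "bij_betw f A B"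
    and f: "f \<in> measurable (restrict_space M A) (restrict_space (lebesgue_atoms c p) B)"
    and f_inv: "the_inv_into A f \<in> measurable (restrict_space (lebesgue_atoms c p) B) (restrict_space M A)"
    and em: "\<forall>E\<in>sets M. E \<subseteq> A \<longrightarrow> emeasure (lebesgue_atoms c p) (f ` E) = emeasure M E"
    unfolding isomorphic_mod0_def by (elim exE conjE)
  define N where "N = lebesgue_atoms c p"
  define S where "S = lebesgue_atoms_space c"
  have AM: "A \<in> sets M" and BN: "B \<in> sets N"
    using A B by (auto simp: full_measure_def N_def)
  have inj: "inj_on f A" and img: "f ` A = B" using bij by (auto simp: bij_betw_def)
  have spA: "space (restrict_space M A) = A"
    using sets.sets_into_space[OF AM] by (auto simp: space_restrict_space)
  have spB: "space (restrict_space N B) = B"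
    using sets.sets_into_space[OF BN] by (auto simp: space_restrict_space)
  have setsN: "sets N = sets (lebesgue_on S)" by (simp add: N_def S_def)
  have S: "S \<in> sets lebesgue" unfolding S_def by (rule lebesgue_atoms_space_sets)
  have setsN_iff: "X \<in> sets N \<longleftrightarrow> X \<in> sets lebesgue \<and> X \<subseteq> S" for X
    unfolding setsN using S by (subst sets_restrict_space_iff) (simp_all, blast)
  have BS: "B \<subseteq> S" using BN setsN_iff by blast
  have meas_f: "f -` X \<inter> A \<in> sets M" if "X \<in> sets lebesgue" for X
  proof -
    have "X \<inter> B \<in> sets (restrict_space N B)"
      using that BN BS setsN_iff by (auto simp: sets_restrict_space_iff)
    then have "f -` (X \<inter> B) \<inter> A \<in> sets (restrict_space M A)"
      using measurable_sets[OF f[folded N_def], of "X \<inter> B"] spA by simp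
    moreover have "f -` (X \<inter> B) \<inter> A = f -` X \<inter> A" unfolding img[symmetric] by blast
    moreover have "A \<inter> space M \<in> sets M" using AM by simp
    ultimately show ?thesis by (simp add: sets_restrict_space_iff)
  qed
  have borel: "f \<in> borel_measurable (restrict_space M A)"
  proof (rule measurableI)
    fix X :: "real set" assume "X \<in> sets borel"
    then have "f -` X \<inter> A \<in> sets M" by (intro meas_f) auto
    then show "f -` X \<inter> space (restrict_space M A) \<in> sets (restrict_space M A)"
      using AM spA by (simp add: sets_restrict_space_iff)
  qed auto
  show thesis
  proof (rule that[OF A inj borel])
    fix E and \<delta> :: real assume E: "E \<in> sets M" "E \<subseteq> A" and \<delta>: "0 < \<delta>"
    define F where "F = f ` E"
    \<comment> \<open>An image is measurable because it is a preimage under the inverse, which the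
      isomorphism assumes measurable.\<close>
    have "the_inv_into A f (f x) = x" if "x \<in> A" for x using inj that by (rule the_inv_into_f_f)
    then have "F = the_inv_into A f -` E \<inter> B" unfolding F_def img[symmetric] using E(2) by force
    moreover have "the_inv_into A f -` E \<inter> B \<in> sets (restrict_space N B)"
      using measurable_sets[OF f_inv[folded N_def], of E] E AM spB by (auto simp: sets_restrict_space_iff)
    ultimately have F: "F \<in> sets lebesgue" "F \<subseteq> S"
      using BN setsN_iff[of F] by (auto simp: sets_restrict_space_iff)
    have pull: "E \<inter> f -` X \<in> sets M" if "X \<in> sets lebesgue" for X
    proof -
      have "E \<inter> f -` X = E \<inter> (f -` X \<inter> A)" using E by auto
      then show ?thesis using E meas_f[OF that] by auto
    qed
    \<comment> \<open>All atoms of the model sit at negative points, so on \<open>F1\<close> only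
      Lebesgue measure is felt and approximation by closed sets applies.\<close>
    define F1 where "F1 = F \<inter> {0..c}"
    have F1: "F1 \<in> sets lebesgue" using F unfolding F1_def by auto
    have "0 < \<delta> / 2" using \<delta> by simp
    from sets_lebesgue_inner_closed[OF F1 this] obtain K where
      K: "closed K" "K \<subseteq> F1" "emeasure lebesgue (F1 - K) < ennreal (\<delta> / 2)" .
    have "compact K"
      using K(1,2) bounded_subset[of "{0..c}" K] by (auto simp: compact_eq_bounded_closed F1_def)
    have small1: "measure M (E \<inter> f -` (F1 - K)) < \<delta> / 2"
    proof -
      have FK: "F1 - K \<in> sets lebesgue" using F1 K(1) by auto
      have img1: "f ` (E \<inter> f -` (F1 - K)) = F1 - K" by (auto simp: F1_def F_def)
      have "E \<inter> f -` (F1 - K) \<subseteq> A" using E by blast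
      with em pull[OF FK] have "emeasure N (f ` (E \<inter> f -` (F1 - K))) = emeasure M (E \<inter> f -` (F1 - K))"
        unfolding N_def by blast
      then have "emeasure M (E \<inter> f -` (F1 - K)) = emeasure N (F1 - K)" by (simp only: img1)
      also have "\<dots> = emeasure lebesgue (F1 - K) + (\<Sum>n. p n * indicator (F1 - K) (- real (Suc n)))"
        unfolding N_def
      proof (rule emeasure_lebesgue_atoms)
        have "F1 - K \<subseteq> S" using F by (auto simp: F1_def)
        then show "F1 - K \<in> sets (lebesgue_on (lebesgue_atoms_space c))"
          using FK setsN_iff[of "F1 - K"] setsN by (simp add: S_def)
      qed
      also have "(\<lambda>n. p n * indicator (F1 - K) (- real (Suc n))) = (\<lambda>n. 0)"
      proof
        fix n
        have "- real (Suc n) \<notin> F1 - K" by (simp add: F1_def)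
        then show "p n * indicator (F1 - K) (- real (Suc n)) = 0" by (simp only: indicator_simps mult_zero_right not_False_eq_True)
      qed
      finally have "emeasure M (E \<inter> f -` (F1 - K)) < ennreal (\<delta> / 2)" using K by simp
      then show ?thesis using \<delta> by (simp add: emeasure_eq_measure ennreal_less_iff)
    qed
    \<comment> \<open>The first \<open>m\<close> atom positions form a finite, hence compact, set.
      Continuity from below makes the remaining atoms negligible.\<close>
    define P where "P m = (\<lambda>n. - real (Suc n)) ` {..<m}" for m :: nat
    have Pm: "E \<inter> f -` P m \<in> sets M" for m
    proof (rule pull, rule sets_completionI_sets)
      have "finite (P m)" by (simp add: P_def)
      then show "P m \<in> sets lborel" by (simp add: finite_imp_closed)
    qed
    have "(\<lambda>m. measure M (E \<inter> f -` P m)) \<longlonglongrightarrow> measure M (\<Union>m. E \<inter> f -` P m)"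
      by (intro finite_Lim_measure_incseq) (use Pm in \<open>auto simp: incseq_def P_def\<close>)
    from LIMSEQ_D[OF this, of "\<delta> / 2"] \<delta>
    obtain m where "norm (measure M (E \<inter> f -` P m) - measure M (\<Union>m. E \<inter> f -` P m)) < \<delta> / 2"
      by auto
    then have m: "measure M (\<Union>m. E \<inter> f -` P m) - measure M (E \<inter> f -` P m) < \<delta> / 2"
      unfolding real_norm_def by linarith
    have small2: "measure M ((\<Union>m. E \<inter> f -` P m) - E \<inter> f -` P m) < \<delta> / 2"
    proof -
      have "(\<Union>m. E \<inter> f -` P m) \<in> sets M" using Pm by (intro sets.countable_UN') auto
      from finite_measure_Diff[OF this Pm UN_upper[OF UNIV_I]] m show ?thesis by (simp only:)
    qed
    have "E - f -` (K \<union> (P m \<inter> F)) \<subseteq>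
        E \<inter> f -` (F1 - K) \<union> ((\<Union>m. E \<inter> f -` P m) - E \<inter> f -` P m)"
    proof
      fix x assume x: "x \<in> E - f -` (K \<union> (P m \<inter> F))"
      then have "f x \<in> F" by (auto simp: F_def)
      then have "f x \<in> {0..c} \<or> (\<exists>n. f x = - real (Suc n))"
        using F by (auto simp: S_def lebesgue_atoms_space_def)
      then show "x \<in> E \<inter> f -` (F1 - K) \<union> ((\<Union>m. E \<inter> f -` P m) - E \<inter> f -` P m)"
      proof
        assume "f x \<in> {0..c}"
        then show ?thesis using x \<open>f x \<in> F\<close> by (auto simp: F1_def)
      next
        assume "\<exists>n. f x = - real (Suc n)"
        then obtain n where "f x = - real (Suc n)" ..
        then have "f x \<in> P (Suc n)" by (auto simp: P_def)
        then show ?thesis using x \<open>f x \<in> F\<close> by auto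
      qed
    qed
    moreover have sets: "E \<inter> f -` (F1 - K) \<in> sets M" "(\<Union>m. E \<inter> f -` P m) - E \<inter> f -` P m \<in> sets M"
    proof -
      show "E \<inter> f -` (F1 - K) \<in> sets M" using F1 K(1) by (intro pull) auto
      have "(\<Union>m. E \<inter> f -` P m) \<in> sets M" using Pm by (intro sets.countable_UN') auto
      then show "(\<Union>m. E \<inter> f -` P m) - E \<inter> f -` P m \<in> sets M" using Pm by (rule sets.Diff)
    qed
    ultimately have "measure M (E - f -` (K \<union> (P m \<inter> F))) \<le>
        measure M (E \<inter> f -` (F1 - K) \<union> ((\<Union>m. E \<inter> f -` P m) - E \<inter> f -` P m))"
      by (intro finite_measure_mono sets.Un)
    also have "\<dots> \<le> measure M (E \<inter> f -` (F1 - K)) + measure M ((\<Union>m. E \<inter> f -` P m) - E \<inter> f -` P m)"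
      by (rule measure_Un_le[OF sets])
    also have "\<dots> < \<delta>" using small1 small2 by simp
    finally have "measure M (E - f -` (K \<union> (P m \<inter> F))) < \<delta>" .
    moreover have "compact (K \<union> (P m \<inter> F))"
      by (intro compact_Un[OF \<open>compact K\<close>] finite_imp_compact) (simp add: P_def)
    moreover have "K \<union> (P m \<inter> F) \<subseteq> f ` E" using K(2) by (auto simp: F1_def F_def)
    ultimately show "\<exists>C. compact C \<and> C \<subseteq> f ` E \<and> measure M (E - f -` C) < \<delta>" by blast
  qed
qed

text \<open>The aim is to replace an index \<open>l\<close> that depends on the pair of points by
  one from a finite range. Transported by \<open>g\<close>, all the sets \<open>E\<close>,
  \<open>U l\<close> and \<open>W l\<close> become relatively clopen on one large compact set; the
  separating rectangles then form an open cover of a compact product.\<close>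

lemma compact_separation:
  fixes M :: "'a measure" and U W :: "nat \<Rightarrow> 'a set"
  assumes std: "standard_probability_space M"
    and UW: "\<And>l. U l \<in> sets M" "\<And>l. W l \<in> sets M"
    and X: "full_measure M X" and E: "E \<in> sets M" and \<delta>: "0 < \<delta>"
    and sep: "\<And>x y. x \<in> X \<inter> E \<Longrightarrow> y \<in> X - E \<Longrightarrow> \<exists>l. x \<in> U l \<and> y \<in> W l"
  obtains K n where "K \<in> sets M" "measure M (space M - K) < \<delta>"
    "\<And>x y. x \<in> K \<inter> E \<Longrightarrow> y \<in> K - E \<Longrightarrow> \<exists>l<n. x \<in> U l \<and> y \<in> W l"
proof -
  interpret prob_space M using std by (simp add: standard_probability_space_def)
  obtain g :: "'a \<Rightarrow> real" and A where A: "full_measure M A" and inj: "inj_on g A"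
    and g: "g \<in> borel_measurable (restrict_space M A)"
    and approx: "\<And>E \<delta>. E \<in> sets M \<Longrightarrow> E \<subseteq> A \<Longrightarrow> 0 < \<delta> \<Longrightarrow>
       \<exists>C. compact C \<and> C \<subseteq> g ` E \<and> measure M (E - g -` C) < \<delta>"
    using standard_compact_approximation[OF std] by metis
  define Y where "Y = A \<inter> X"
  have sets: "A \<in> sets M" "X \<in> sets M" "Y \<in> sets M" using A X by (auto simp: full_measure_def Y_def)
  have "AE x in M. x \<in> Y" using A X by (auto simp: full_measure_def Y_def)
  then have null: "measure M (space M - Y) = 0"
    using sets prob_Collect_eq_1[of "\<lambda>x. x \<in> Y"] prob_compl[of Y]
    by (simp add: Collect_conj_eq sets.Int_space_eq1[symmetric] AE_in_set_eq_1)
  have pre: "g -` C \<inter> Y \<in> sets M" if "closed C" for C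
  proof -
    have "g -` C \<inter> space (restrict_space M A) \<in> sets (restrict_space M A)"
      using measurable_sets[OF g] that by auto
    then have "g -` C \<inter> A \<in> sets M"
      using sets sets.sets_into_space[OF sets(1)]
      by (auto simp: sets_restrict_space_iff space_restrict_space Int_absorb2)
    then have "(g -` C \<inter> A) \<inter> Y \<in> sets M" using sets by blast
    then show ?thesis by (simp add: Y_def Int_ac)
  qed
  \<comment> \<open>Approximating both \<open>S\<close> and its complement from inside by compact
    sets, which are disjoint because \<open>g\<close> is injective on \<open>Y\<close>, makes
    \<open>S\<close> relatively clopen on what is kept.\<close>
  have two_sided: "\<exists>C. compact (fst C) \<and> compact (snd C) \<and> fst C \<subseteq> g ` (Y \<inter> S) \<and> snd C \<subseteq> g ` (Y - S) \<and>
      measure M (space M - g -` (fst C \<union> snd C) \<inter> Y) < e" if S: "S \<in> sets M" and e: "0 < e" for S e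
  proof -
    obtain C where C: "compact C" "C \<subseteq> g ` (Y \<inter> S)" "measure M (Y \<inter> S - g -` C) < e / 2"
      using approx[of "Y \<inter> S" "e / 2"] sets S e by (auto simp: Y_def)
    obtain D where D: "compact D" "D \<subseteq> g ` (Y - S)" "measure M (Y - S - g -` D) < e / 2"
      using approx[of "Y - S" "e / 2"] sets S e by (auto simp: Y_def)
    have m: "Y \<inter> S - g -` C \<in> sets M" "Y - S - g -` D \<in> sets M"
    proof -
      have "Y \<inter> S - g -` C = Y \<inter> S - (g -` C \<inter> Y)" "Y - S - g -` D = Y - S - (g -` D \<inter> Y)" by auto
      then show "Y \<inter> S - g -` C \<in> sets M" "Y - S - g -` D \<in> sets M"
        using sets S pre C(1) D(1) by (auto simp: compact_imp_closed)
    qed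
    have "measure M (space M - g -` (C \<union> D) \<inter> Y) \<le>
        measure M ((space M - Y) \<union> ((Y \<inter> S - g -` C) \<union> (Y - S - g -` D)))"
      using m sets by (intro finite_measure_mono) auto
    also have "\<dots> \<le> measure M (space M - Y) + (measure M (Y \<inter> S - g -` C) + measure M (Y - S - g -` D))"
      using m sets by (intro order_trans[OF measure_Un_le] add_mono measure_Un_le) auto
    also have "\<dots> < e" using null C D by simp
    finally show ?thesis using C D by (intro exI[of _ "(C, D)"]) auto
  qed
  \<comment> \<open>\<open>E\<close>, the \<open>U l\<close> and the \<open>W l\<close> are
    interleaved into one sequence, so that losses of \<open>\<delta> / 2 * (1 / 2) ^ Suc n\<close>
    add up to only \<open>\<delta> / 2\<close>.\<close>
  define V where "V n = (if n = 0 then E else if odd n then U (n div 2) else W (n div 2 - 1))" for n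
  have V: "V n \<in> sets M" for n using UW E by (auto simp: V_def)
  have VU: "V (2 * l + 1) = U l" and VW: "V (2 * l + 2) = W l" for l by (auto simp: V_def)
  have "\<forall>n. \<exists>C. compact (fst C) \<and> compact (snd C) \<and> fst C \<subseteq> g ` (Y \<inter> V n) \<and> snd C \<subseteq> g ` (Y - V n) \<and>
      measure M (space M - g -` (fst C \<union> snd C) \<inter> Y) < \<delta> / 2 * (1 / 2) ^ Suc n"
    using V \<delta> by (intro allI two_sided) auto
  from choice[OF this] obtain CD where CD: "\<And>n. compact (fst (CD n)) \<and> compact (snd (CD n)) \<and>
      fst (CD n) \<subseteq> g ` (Y \<inter> V n) \<and> snd (CD n) \<subseteq> g ` (Y - V n) \<and>
      measure M (space M - g -` (fst (CD n) \<union> snd (CD n)) \<inter> Y) < \<delta> / 2 * (1 / 2) ^ Suc n" by blast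
  define C where "C n = fst (CD n)" for n
  define D where "D n = snd (CD n)" for n
  have C: "compact (C n)" "C n \<subseteq> g ` (Y \<inter> V n)" and D: "compact (D n)" "D n \<subseteq> g ` (Y - V n)"
    and meas: "measure M (space M - g -` (C n \<union> D n) \<inter> Y) < \<delta> / 2 * (1 / 2) ^ Suc n" for n
    using CD[of n] by (auto simp: C_def D_def)
  define K0 where "K0 = (\<Inter>n. C n \<union> D n)"
  have cl: "closed (C n \<union> D n)" for n using C D by (intro closed_Un compact_imp_closed)
  have "closed K0" unfolding K0_def using cl by auto
  have K0Y: "K0 \<subseteq> g ` Y" 
  proof -
    have "K0 \<subseteq> C 0 \<union> D 0" by (auto simp: K0_def)
    then show ?thesis using C(2)[of 0] D(2)[of 0] by blast
  qed
  define K where "K = g -` K0 \<inter> Y"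
  have K: "K \<in> sets M" unfolding K_def by (rule pre) fact
  have inY: "g x = g y \<Longrightarrow> x = y" if "x \<in> Y" "y \<in> Y" for x y
    using inj that by (auto simp: Y_def inj_on_def)
  have CD_cover: "g x \<in> C n \<or> g x \<in> D n" "x \<in> Y" if "x \<in> K" for x n
    using that by (auto simp: K_def K0_def)
  have notD: "g x \<notin> D n" if "x \<in> Y" "x \<in> V n" for x n
    using that D(2)[of n] inY by blast
  have notC: "g x \<notin> C n" if "x \<in> Y" "x \<notin> V n" for x n
    using that C(2)[of n] inY by blast
  have inC: "g x \<in> C n \<and> g x \<notin> D n" if "x \<in> K" "x \<in> V n" for x n
    using that CD_cover notD by blast
  have inD: "g x \<in> D n \<and> g x \<notin> C n" if "x \<in> K" "x \<notin> V n" for x n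
    using that CD_cover notC by blast
  have mK: "measure M (space M - K) < \<delta>"
  proof -
    let ?B = "\<lambda>n. space M - g -` (C n \<union> D n) \<inter> Y"
    have B: "?B n \<in> sets M" for n using pre[OF cl[of n]] by auto
    have s: "(\<lambda>n. \<delta> / 2 * (1 / 2) ^ Suc n) sums (\<delta> / 2 * 1)"
      by (intro sums_mult power_half_series)
    have sm: "summable (\<lambda>n. measure M (?B n))"
      by (rule summable_comparison_test'[OF sums_summable[OF s], of 0]) (use meas in \<open>auto intro: less_imp_le\<close>)
    have "space M - K = (\<Union>n. ?B n)" by (auto simp: K_def K0_def)
    then have "measure M (space M - K) \<le> (\<Sum>n. measure M (?B n))"
      using B sm by (simp only:) (intro finite_measure_subadditive_countably, auto)
    also have "\<dots> \<le> (\<Sum>n. \<delta> / 2 * (1 / 2) ^ Suc n)"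
      by (intro suminf_le sm sums_summable[OF s] less_imp_le meas)
    also have "\<dots> = \<delta> / 2" using sums_unique[OF s] by simp
    finally show ?thesis using \<delta> by simp
  qed
  let ?P = "(C 0 \<inter> K0) \<times> (D 0 \<inter> K0)"
  have cP: "compact ?P" using C(1) D(1) \<open>closed K0\<close> by (intro compact_Times compact_Int_closed)
  \<comment> \<open>On \<open>K0\<close>, avoiding the compact set \<open>D n\<close> amounts to
    lying in \<open>C n\<close>, that is, to coming from \<open>V n\<close>. Complements of the
    \<open>D n\<close> are used because they are open.\<close>
  define O' where "O' l = (- D (2 * l + 1)) \<times> (- D (2 * l + 2))" for l
  have opn: "open (O' l)" for l unfolding O'_def using D(1) by (intro open_Times) (auto intro: compact_imp_closed)
  have "?P \<subseteq> (\<Union>l. O' l)"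
  proof
    fix z assume z: "z \<in> ?P"
    have "fst z \<in> g ` Y" "snd z \<in> g ` Y" using z K0Y by auto
    then obtain x y where xy: "z = (g x, g y)" "x \<in> Y" "y \<in> Y"
      by (metis imageE prod.collapse)
    then have gz: "g x \<in> C 0" "g x \<in> K0" "g y \<in> D 0" "g y \<in> K0" using z by auto
    then have "x \<in> K" "y \<in> K" using xy by (auto simp: K_def)
    then have "x \<in> V 0" "y \<notin> V 0" using gz inC inD by blast+
    then have "x \<in> X \<inter> E" "y \<in> X - E" using xy by (auto simp: V_def Y_def)
    from sep[OF this] obtain l where "x \<in> U l" "y \<in> W l" by blast
    then have "z \<in> O' l"
      using inC[OF \<open>x \<in> K\<close>, of "2 * l + 1"] inC[OF \<open>y \<in> K\<close>, of "2 * l + 2"] xy VU VW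
      by (simp only: O'_def) blast
    then show "z \<in> (\<Union>l. O' l)" by blast
  qed
  then obtain L where L: "finite L" "?P \<subseteq> (\<Union>l\<in>L. O' l)"
    using compactE_image[OF cP, of UNIV O'] opn by (metis (no_types, lifting) UNIV_I)
  obtain n where n: "\<And>l. l \<in> L \<Longrightarrow> l < n"
    using L(1) by (metis finite_nat_set_iff_bounded)
  show thesis
  proof (rule that[OF K mK])
    fix x y assume xy: "x \<in> K \<inter> E" "y \<in> K - E"
    then have "(g x, g y) \<in> ?P"
      using inC[of x 0] inD[of y 0] by (simp add: V_def) (simp add: K_def)
    then obtain l where l: "l \<in> L" "(g x, g y) \<in> O' l" using L by blast
    then have "x \<in> V (2 * l + 1)" "y \<in> V (2 * l + 2)"
      using inD[of x "2 * l + 1"] inD[of y "2 * l + 2"] xy by (simp_all only: O'_def) blast+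
    then show "\<exists>l<n. x \<in> U l \<and> y \<in> W l" using l n VU VW by metis
  qed
qed

section \<open>Separation by a generating semimetric\<close>

lemma full_measure_AE:
  assumes "AE x in M. P x"
  obtains X where "full_measure M X" "\<And>x. x \<in> X \<Longrightarrow> P x"
proof -
  from AE_E3[OF assms] obtain N where N: "\<And>x. x \<in> space M - N \<Longrightarrow> P x" "N \<in> null_sets M"
    by this blast
  have "full_measure M (space M - N)"
    using N(2) AE_not_in[OF N(2)] by (auto simp: full_measure_def)
  then show thesis by (rule that) (rule N(1))
qed

lemma full_measure_Int:
  "full_measure M A \<Longrightarrow> full_measure M B \<Longrightarrow> full_measure M (A \<inter> B)"
  by (auto simp: full_measure_def)

lemma full_measure_subset_space: "full_measure M A \<Longrightarrow> A \<subseteq> space M"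
  by (auto simp: full_measure_def dest: sets.sets_into_space)

lemma (in prob_space) full_measure_nonempty:
  assumes "full_measure M A" shows "A \<noteq> {}"
proof
  assume "A = {}"
  with assms have "AE x in M. x \<in> {}" by (simp only: full_measure_def)
  then show False by simp
qed

lemma (in prob_space) full_measure_compl:
  assumes "full_measure M A" shows "prob (space M - A) = 0"
  using assms prob_compl[of A] prob_eq_1[of A] by (simp add: full_measure_def)

lemma (in complete_measure) borel_measurable_AE_eq:
  fixes f g :: "'a \<Rightarrow> real"
  assumes f: "f \<in> borel_measurable M" and ae: "AE x in M. f x = g x"
  shows "g \<in> borel_measurable M"
proof (rule measurableI)
  fix A :: "real set" assume A: "A \<in> sets borel"
  show "g -` A \<inter> space M \<in> sets M"
  proof (rule in_sets_AE)
    show "AE x in M. x \<in> f -` A \<inter> space M \<longleftrightarrow> x \<in> g -` A \<inter> space M"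
      using ae by eventually_elim simp
    show "f -` A \<inter> space M \<in> sets M" using f A by (rule measurable_sets)
  qed simp
qed simp

text \<open>Measurability is given only for the completed product, where Fubini is not directly
  available. A product-measurable version \<open>f\<close> has good sections, and completeness of
  \<open>M\<close> carries them back to almost every section of \<open>\<rho>\<close>.\<close>

lemma AE_section_measurable:
  fixes \<rho> :: "'a \<Rightarrow> 'a \<Rightarrow> real"
  assumes "prob_space M" "complete_measure M"
    and meas: "(\<lambda>(x, y). \<rho> x y) \<in> borel_measurable (completion (M \<Otimes>\<^sub>M M))"
  shows "AE x in M. \<rho> x \<in> borel_measurable M"
    and "integrable (completion (M \<Otimes>\<^sub>M M)) (\<lambda>(x, y). \<rho> x y) \<Longrightarrow> AE x in M. integrable M (\<rho> x)"
proof -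
  interpret prob_space M by fact
  interpret complete_measure M by fact
  interpret P: pair_sigma_finite M M ..
  obtain f where f: "f \<in> borel_measurable (M \<Otimes>\<^sub>M M)"
    and ae: "AE z in M \<Otimes>\<^sub>M M. (\<lambda>(x, y). \<rho> x y) z = f z"
    using completion_ex_borel_measurable_real[OF meas] by blast
  have ae2: "AE x in M. AE y in M. \<rho> x y = f (x, y)"
    using P.AE_pair[OF ae] by simp
  show sec: "AE x in M. \<rho> x \<in> borel_measurable M"
    using ae2 AE_space
  proof eventually_elim
    case (elim x)
    have "(\<lambda>y. f (x, y)) \<in> borel_measurable M"
      using f elim(2) by measurable
    then show ?case
      by (rule borel_measurable_AE_eq) (use elim(1) in auto)
  qed
  assume int: "integrable (completion (M \<Otimes>\<^sub>M M)) (\<lambda>(x, y). \<rho> x y)"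
  have "integrable (completion (M \<Otimes>\<^sub>M M)) f"
    using int integrable_cong_AE[OF meas measurable_completion[OF f] AE_completion[OF ae]] by simp
  then have "integrable (M \<Otimes>\<^sub>M M) f" using integrable_completion[OF f] by simp
  from P.AE_integrable_fst'[OF this] have "AE x in M. integrable M (\<lambda>y. f (x, y))" .
  then show "AE x in M. integrable M (\<rho> x)"
    using ae2 sec
  proof eventually_elim
    case (elim x)
    show ?case
      by (rule integrable_cong_AE_imp[OF elim(1) elim(3)]) (use elim(2) in auto)
  qed
qed

text \<open>The given dense points may themselves have non-measurable sections. They are replaced by
  nearby points of the full-measure set on which the sections are measurable, at the price of a
  factor two in distance.\<close>

lemma admissible_dense_sequence:
  assumes prob: "prob_space M" and complete: "complete_measure M" and adm: "admissible M \<rho>"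
  obtains Y and d :: "nat \<Rightarrow> 'a" where "full_measure M Y" "range d \<subseteq> Y"
    "\<And>i. \<rho> (d i) \<in> borel_measurable M" "\<And>x e. x \<in> Y \<Longrightarrow> 0 < e \<Longrightarrow> \<exists>i. \<rho> x (d i) < e"
proof -
  interpret prob_space M by fact
  have ms: "semimetric_on (space M) \<rho>"
    and meas: "(\<lambda>(x, y). \<rho> x y) \<in> borel_measurable (completion (M \<Otimes>\<^sub>M M))"
    using adm by (auto simp: admissible_def measurable_semimetric_def)
  obtain X1 D where X1: "full_measure M X1" and D: "countable D" "D \<subseteq> X1"
    "\<And>x e. x \<in> X1 \<Longrightarrow> 0 < e \<Longrightarrow> \<exists>p\<in>D. \<rho> x p < e"
    using adm unfolding admissible_def semimetric_separable_def by blast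
  obtain G where G: "full_measure M G" "\<And>x. x \<in> G \<Longrightarrow> \<rho> x \<in> borel_measurable M"
    using full_measure_AE[OF AE_section_measurable(1)[OF prob complete meas]] by metis
  define Y where "Y = X1 \<inter> G"
  have Y: "full_measure M Y" unfolding Y_def using X1 G by (intro full_measure_Int)
  define near where "near p k x \<longleftrightarrow> x \<in> Y \<and> \<rho> x p < 1 / real (Suc k)" for p k x
  \<comment> \<open>One admissible point is chosen from each ball of radius \<open>1 / Suc k\<close>
    around a dense point \<open>p\<close>, whenever that ball meets \<open>Y\<close>.\<close>
  define E where "E = (\<lambda>(p, k). SOME x. near p k x) ` {(p, k). p \<in> D \<and> (\<exists>x. near p k x)}"
  have "countable {(p, k :: nat). p \<in> D \<and> (\<exists>x. near p k x)}"
    by (rule countable_subset[of _ "D \<times> UNIV"]) (use D in auto)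
  then have "countable E" unfolding E_def by (rule countable_image)
  have EY: "E \<subseteq> Y"
    unfolding E_def by (auto intro: someI2[where Q = "\<lambda>x. x \<in> Y"] simp: near_def)
  have dense: "\<exists>z\<in>E. \<rho> x z < e" if x: "x \<in> Y" and e: "0 < e" for x e
  proof -
    obtain k where k: "1 / real (Suc k) < e / 2" using nat_approx_posE[of "e / 2"] e by auto
    obtain p where p: "p \<in> D" "\<rho> x p < 1 / real (Suc k)"
      using D(3)[of x "1 / real (Suc k)"] x by (auto simp: Y_def)
    have ex: "near p k x" using x p by (simp add: near_def)
    define z where "z = (SOME z. near p k z)"
    have z: "near p k z" unfolding z_def using ex by (rule someI)
    have "z \<in> E" unfolding E_def z_def using p(1) ex by auto
    have "x \<in> space M" "z \<in> space M" "p \<in> space M"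
      using x z p D(2) full_measure_subset_space[OF Y] full_measure_subset_space[OF X1]
      by (auto simp: near_def)
    then have "\<rho> x z \<le> \<rho> x p + \<rho> p z" "\<rho> p z = \<rho> z p"
      using ms unfolding semimetric_on_def by blast+
    moreover have "\<rho> z p < 1 / real (Suc k)" using z by (simp add: near_def)
    ultimately have "\<rho> x z < e" using p(2) k by linarith
    then show ?thesis using \<open>z \<in> E\<close> by blast
  qed
  obtain x0 where "x0 \<in> Y" using full_measure_nonempty[OF Y] by blast
  then have "E \<noteq> {}" using dense[of x0 1] by auto
  define d where "d = from_nat_into E"
  have rng: "range d = E"
    unfolding d_def using \<open>countable E\<close> \<open>E \<noteq> {}\<close> by (rule range_from_nat_into[rotated])
  show thesis
  proof (rule that[OF Y])
    show "range d \<subseteq> Y" using rng EY by simp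
    show "\<rho> (d i) \<in> borel_measurable M" for i
      using rng EY by (intro G(2)) (auto simp: Y_def)
    show "\<exists>i. \<rho> x (d i) < e" if "x \<in> Y" "0 < e" for x e
      using dense[OF that] rng by (metis rangeE)
  qed
qed

section \<open>Two-sided orbits and uniform separation\<close>

locale aut_system =
  fixes M :: "'a measure" and T :: "'a \<Rightarrow> 'a"
  assumes std: "standard_probability_space M" and aut: "automorphism M T"
begin

sublocale mps M T
proof -
  interpret prob_space M using std by (simp add: standard_probability_space_def)
  show "mps M T"
    using aut by unfold_locales (auto simp: automorphism_def measure_preserving_map_def)
qed

lemma complete: "complete_measure M"
  using std by (simp add: standard_probability_space_def)

text \<open>This is literally the choice made inside \<open>aut_power\<close>, so negative powers
  are iterates of \<open>S\<close>.\<close>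

definition S :: "'a \<Rightarrow> 'a" where "S = (SOME S. inverse_mod0 M T S)"

lemma S_inverse: "inverse_mod0 M T S"
proof -
  have "\<exists>S. inverse_mod0 M T S" using aut by (simp add: automorphism_def)
  then show ?thesis unfolding S_def by (rule someI_ex)
qed

sublocale inv: mps M S
  using S_inverse by unfold_locales (auto simp: inverse_mod0_def measure_preserving_map_def)

lemma aut_power_eq: "aut_power M T k = (if 0 \<le> k then T ^^ nat k else S ^^ nat (- k))"
  by (simp add: aut_power_def S_def)

lemma aut_power_meas [measurable]: "aut_power M T k \<in> measurable M M"
  by (simp add: aut_power_eq)

lemma AE_aut_power:
  assumes "AE x in M. P x"
  shows "AE x in M. \<forall>k. P (aut_power M T k x)"
proof -
  have "AE x in M. \<forall>k. P ((T ^^ k) x)" "AE x in M. \<forall>k. P ((S ^^ k) x)"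
    using AE_iter[OF assms] inv.AE_iter[OF assms] by auto
  then show ?thesis by eventually_elim (auto simp: aut_power_eq)
qed

text \<open>\<open>S\<close> undoes \<open>T\<close> only almost everywhere. Keeping the points
  whose entire forward orbit lies in the good set gives a forward invariant set on which
  cancellation can be iterated.\<close>

lemma invertible_core:
  obtains G where "full_measure M G" "\<And>x. x \<in> G \<Longrightarrow> T x \<in> G" "\<And>x. x \<in> G \<Longrightarrow> S (T x) = x"
proof -
  have "AE x in M. S (T x) = x" using S_inverse by (simp add: inverse_mod0_def)
  from full_measure_AE[OF this] obtain X where X: "full_measure M X" "\<And>x. x \<in> X \<Longrightarrow> S (T x) = x"
    by this blast
  have XM: "X \<in> sets M" using X by (simp add: full_measure_def)
  define G where "G = {x \<in> space M. \<forall>k. (T ^^ k) x \<in> X}"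
  have "G = (\<Inter>k. (T ^^ k) -` X \<inter> space M)" by (auto simp: G_def)
  also have "\<dots> \<in> sets M" using XM by (intro sets.countable_INT) (auto intro: measurable_sets[OF iter_meas])
  finally have "G \<in> sets M" .
  moreover have "AE x in M. \<forall>k. (T ^^ k) x \<in> X"
    using X(1) by (intro AE_iter) (simp add: full_measure_def)
  then have "AE x in M. x \<in> G" using AE_space by eventually_elim (auto simp: G_def)
  ultimately have G: "full_measure M G" by (simp add: full_measure_def)
  show thesis
  proof (rule that[OF G])
    fix x assume x: "x \<in> G"
    then have x': "x \<in> space M" "(T ^^ k) x \<in> X" for k unfolding G_def by auto
    have "(T ^^ k) (T x) \<in> X" for k using x'(2)[of "Suc k"] by (simp only: funpow_Suc_right comp_apply)
    then show "T x \<in> G" using measurable_space[OF T_meas x'(1)] unfolding G_def by simp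
    show "S (T x) = x" using X(2) x'(2)[of 0] by simp
  qed
qed

text \<open>Lets a two-sided window be read along a forward orbit: after \<open>m\<close> steps
  forward, up to \<open>m\<close> steps back only cancel factors of \<open>T\<close>.\<close>

lemma aut_power_shift:
  assumes G: "\<And>x. x \<in> G \<Longrightarrow> T x \<in> G" "\<And>x. x \<in> G \<Longrightarrow> S (T x) = x"
    and x: "x \<in> G" and k: "\<bar>k\<bar> \<le> int m"
  shows "aut_power M T k ((T ^^ m) x) = (T ^^ nat (int m + k)) x"
proof (cases "0 \<le> k")
  case True
  then have "nat (int m + k) = nat k + m" by simp
  then show ?thesis using True by (simp add: aut_power_eq funpow_add)
next
  case False
  have iterG: "(T ^^ i) x \<in> G" for i by (induction i) (use x G in auto)
  have cancel: "(S ^^ j) ((T ^^ (j + i)) x) = (T ^^ i) x" for i j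
  proof (induction j)
    case (Suc j)
    have "(S ^^ Suc j) ((T ^^ (Suc j + i)) x) = (S ^^ j) (S (T ((T ^^ (j + i)) x)))"
      by (simp only: funpow_Suc_right comp_apply) simp
    then show ?case using Suc G(2)[OF iterG] by simp
  qed simp
  define j where "j = nat (- k)"
  have "m = j + nat (int m + k)" using False k by (simp add: j_def)
  then have "(S ^^ j) ((T ^^ m) x) = (T ^^ nat (int m + k)) x" by (metis cancel)
  then show ?thesis using False by (simp add: aut_power_eq j_def)
qed

text \<open>Generation gives, for each pair, some power with positive distance but no uniform gap
  and no bound on the power. Distances to the dense points \<open>d i\<close>, compared with
  rational thresholds, turn this into countably many measurable conditions, to which compactness
  applies; the triangle inequality (\<open>f_diff\<close>) returns from these functions to
  \<open>\<rho>\<close>.\<close>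

lemma generating_separates_set:
  assumes adm: "admissible M \<rho>" and gen: "generating M T \<rho>"
    and E: "E \<in> sets M" and \<delta>: "0 < \<delta>"
  obtains K m r where "K \<in> sets M" "measure M (space M - K) < \<delta>" "0 < r"
    "\<And>x y. x \<in> K \<inter> E \<Longrightarrow> y \<in> K - E \<Longrightarrow>
       \<exists>k. \<bar>k\<bar> \<le> int m \<and> r \<le> \<rho> (aut_power M T k x) (aut_power M T k y)"
proof -
  have ms: "semimetric_on (space M) \<rho>"
    using adm by (auto simp: admissible_def measurable_semimetric_def)
  obtain Y and d :: "nat \<Rightarrow> 'a" where Y: "full_measure M Y" and d: "range d \<subseteq> Y"
    and dm: "\<And>i. \<rho> (d i) \<in> borel_measurable M"
    and dense: "\<And>x e. x \<in> Y \<Longrightarrow> 0 < e \<Longrightarrow> \<exists>i. \<rho> x (d i) < e"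
    using admissible_dense_sequence[OF prob_space_axioms complete adm] by metis
  have tri: "\<rho> x z \<le> \<rho> x y + \<rho> y z" and sym: "\<rho> x y = \<rho> y x"
    if "x \<in> space M" "y \<in> space M" "z \<in> space M" for x y z
    using ms that by (auto simp: semimetric_on_def)
  have dsp: "d i \<in> space M" for i using d full_measure_subset_space[OF Y] by auto
  have asp: "aut_power M T k x \<in> space M" if "x \<in> space M" for k x
    using measurable_space[OF aut_power_meas that] .
  define f where "f i k x = \<rho> (d i) (aut_power M T k x)" for i k x
  have f_diff: "\<bar>f i k x - f i k y\<bar> \<le> \<rho> (aut_power M T k x) (aut_power M T k y)"
    if "x \<in> space M" "y \<in> space M" for i k x y
    using tri[OF dsp asp asp, of x y i k k] tri[OF dsp asp asp, of y x i k k] sym[OF asp asp dsp, of x y k k]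
      that by (simp add: f_def abs_le_iff)
  have fm [measurable]: "f i k \<in> borel_measurable M" for i k
    unfolding f_def by (rule measurable_compose[OF aut_power_meas dm])
  obtain X' where X': "full_measure M X'"
    and gen': "\<And>x y. x \<in> X' \<Longrightarrow> y \<in> X' \<Longrightarrow> x \<noteq> y \<Longrightarrow> \<exists>k. translate M T k \<rho> x y > 0"
    using gen unfolding generating_def by metis
  have "AE x in M. \<forall>k. aut_power M T k x \<in> Y"
    using Y by (intro AE_aut_power) (simp add: full_measure_def)
  from full_measure_AE[OF this] obtain X''
    where X'': "full_measure M X''" "\<And>x k. x \<in> X'' \<Longrightarrow> aut_power M T k x \<in> Y"
    by this blast
  define X where "X = X' \<inter> X''"
  have X: "full_measure M X" unfolding X_def by (intro full_measure_Int X' X'')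
  have Xsp: "x \<in> space M" if "x \<in> X" for x using full_measure_subset_space[OF X] that by blast
  \<comment> \<open>One index \<open>l\<close> enumerates all quadruples of dense point, power,
    rational centre and rational radius.\<close>
  define pr :: "nat \<Rightarrow> nat \<times> int \<times> rat \<times> rat" where "pr = from_nat"
  define ii where "ii l = fst (pr l)" for l
  define kk where "kk l = fst (snd (pr l))" for l
  define pp where "pp l = real_of_rat (fst (snd (snd (pr l))))" for l
  define qq where "qq l = real_of_rat (snd (snd (snd (pr l))))" for l
  \<comment> \<open>Membership of \<open>x\<close> in \<open>U l\<close> and of \<open>y\<close> in
    \<open>W l\<close> forces the values of \<open>f\<close> to differ by at least
    \<open>qq l\<close>: the distances to the centre are below \<open>qq l\<close> and above
    \<open>2 * qq l\<close>.\<close>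
  define U where "U l = {x \<in> space M. \<bar>f (ii l) (kk l) x - pp l\<bar> < qq l}" for l
  define W where "W l = {x \<in> space M. \<bar>f (ii l) (kk l) x - pp l\<bar> > 2 * qq l}" for l
  have sep: "\<exists>l. x \<in> U l \<and> y \<in> W l" if x: "x \<in> X \<inter> E" and y: "y \<in> X - E" for x y
  proof -
    have "x \<noteq> y" using x y by auto
    then obtain k where k: "\<rho> (aut_power M T k x) (aut_power M T k y) > 0"
      using gen'[of x y] x y by (auto simp: X_def translate_def)
    define a where "a = aut_power M T k x"
    define b where "b = aut_power M T k y"
    have ab: "0 < \<rho> a b" using k by (simp add: a_def b_def)
    have "a \<in> Y" using X''(2)[of x k] x by (auto simp: a_def X_def)
    \<comment> \<open>A dense point closer to \<open>a\<close> than half of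
      \<open>\<rho> a b\<close> is strictly closer to \<open>a\<close> than to
      \<open>b\<close>.\<close>
    obtain i where i: "\<rho> a (d i) < \<rho> a b / 2" using dense[OF \<open>a \<in> Y\<close>, of "\<rho> a b / 2"] ab by auto
    have asp': "a \<in> space M" "b \<in> space M" using x y Xsp asp by (auto simp: a_def b_def)
    have "\<rho> a b \<le> \<rho> a (d i) + \<rho> (d i) b" using tri[OF asp'(1) dsp asp'(2)] .
    moreover have "\<rho> (d i) a = \<rho> a (d i)" using sym[OF dsp asp'(1) asp'(1)] .
    ultimately have gap: "f i k x < f i k y" using i by (simp add: f_def a_def[symmetric] b_def[symmetric])
    \<comment> \<open>With radius below a third of the gap and centre within \<open>q\<close> above
      \<open>f i k x\<close>, the value at \<open>y\<close> exceeds the centre by more than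
      \<open>2 * q\<close>.\<close>
    obtain q where q: "0 < real_of_rat q" "real_of_rat q < (f i k y - f i k x) / 3"
      using of_rat_dense[of 0 "(f i k y - f i k x) / 3"] gap by auto
    obtain p where p: "f i k x < real_of_rat p" "real_of_rat p < f i k x + real_of_rat q"
      using of_rat_dense[of "f i k x" "f i k x + real_of_rat q"] q by auto
    define l where "l = to_nat (i, k, p, q)"
    have l: "ii l = i" "kk l = k" "pp l = real_of_rat p" "qq l = real_of_rat q"
      by (simp_all add: l_def ii_def kk_def pp_def qq_def pr_def)
    have "x \<in> U l" "y \<in> W l"
      using p q x y Xsp by (auto simp: U_def W_def l)
    then show ?thesis by blast
  qed
  have UW: "U l \<in> sets M" "W l \<in> sets M" for l unfolding U_def W_def by measurable
  obtain K n where K: "K \<in> sets M" "measure M (space M - K) < \<delta>"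
    and fin: "\<And>x y. x \<in> K \<inter> E \<Longrightarrow> y \<in> K - E \<Longrightarrow> \<exists>l<n. x \<in> U l \<and> y \<in> W l"
    using compact_separation[OF std UW X E \<delta> sep] by metis
  \<comment> \<open>Some codes carry a nonpositive radius, for which \<open>U l\<close> is empty, so
    they are left out of the minimum; the extra \<open>1\<close> keeps the set nonempty.\<close>
  define r where "r = Min (insert 1 (qq ` {l. l < n \<and> 0 < qq l}))"
  define m where "m = (\<Sum>l<n. nat \<bar>kk l\<bar>)"
  show thesis
  proof (rule that[OF K])
    show "0 < r" unfolding r_def by (subst Min_gr_iff) auto
    fix x y assume xy: "x \<in> K \<inter> E" "y \<in> K - E"
    then have sp: "x \<in> space M" "y \<in> space M" using sets.sets_into_space[OF K(1)] by auto
    obtain l where l: "l < n" "x \<in> U l" "y \<in> W l" using fin[OF xy] by blast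
    have q: "0 < qq l" using l by (auto simp: U_def)
    have "r \<le> qq l" unfolding r_def using l q by (intro Min_le) auto
    also have "\<dots> \<le> \<bar>f (ii l) (kk l) x - f (ii l) (kk l) y\<bar>" using l by (auto simp: U_def W_def)
    also have "\<dots> \<le> \<rho> (aut_power M T (kk l) x) (aut_power M T (kk l) y)" by (rule f_diff[OF sp])
    finally have "r \<le> \<rho> (aut_power M T (kk l) x) (aut_power M T (kk l) y)" .
    moreover have "nat \<bar>kk l\<bar> \<le> m" unfolding m_def using l(1) by (intro member_le_sum) auto
    then have "\<bar>kk l\<bar> \<le> int m" by linarith
    ultimately show "\<exists>k. \<bar>k\<bar> \<le> int m \<and> r \<le> \<rho> (aut_power M T k x) (aut_power M T k y)" by blast
  qed
qed

text \<open>Each class is separated from its complement with error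
  \<open>\<delta> / card \<xi>\<close>. Intersecting the good sets, taking the least gap and adding
  up the window sizes serves all classes at once.\<close>

lemma generating_separates_partition:
  assumes adm: "admissible M \<rho>" and gen: "generating M T \<rho>"
    and part: "finite_measurable_partition M \<xi>" and \<delta>: "0 < \<delta>"
  obtains K m r where "K \<in> sets M" "measure M (space M - K) < \<delta>" "0 < r"
    "\<And>x y. x \<in> K \<Longrightarrow> y \<in> K \<Longrightarrow> class_of \<xi> x \<noteq> class_of \<xi> y \<Longrightarrow>
       \<exists>k. \<bar>k\<bar> \<le> int m \<and> r \<le> \<rho> (aut_power M T k x) (aut_power M T k y)"
proof -
  interpret mps_partition M T \<xi> by unfold_locales (rule part)
  have cpos: "0 < card \<xi>" using fin part_nonempty by (simp add: card_gt_0_iff)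
  define good where "good E z \<longleftrightarrow> (case z of (K, m, r) \<Rightarrow> K \<in> sets M \<and>
      measure M (space M - K) < \<delta> / real (card \<xi>) \<and> 0 < r \<and>
      (\<forall>x y. x \<in> K \<inter> E \<longrightarrow> y \<in> K - E \<longrightarrow>
       (\<exists>k. \<bar>k\<bar> \<le> int m \<and> r \<le> \<rho> (aut_power M T k x) (aut_power M T k y))))"
    for E and z :: "'a set \<times> nat \<times> real"
  have "\<forall>E\<in>\<xi>. \<exists>z. good E z"
  proof
    fix E assume "E \<in> \<xi>"
    then have E: "E \<in> sets M" by (rule sets_part)
    have "0 < \<delta> / real (card \<xi>)" using \<delta> cpos by simp
    from generating_separates_set[OF adm gen E this] obtain K m r where
      "K \<in> sets M" "measure M (space M - K) < \<delta> / real (card \<xi>)" "0 < r"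
      "\<And>x y. x \<in> K \<inter> E \<Longrightarrow> y \<in> K - E \<Longrightarrow>
         \<exists>k. \<bar>k\<bar> \<le> int m \<and> r \<le> \<rho> (aut_power M T k x) (aut_power M T k y)" by metis
    then have "good E (K, m, r)" by (simp add: good_def)
    then show "\<exists>z. good E z" ..
  qed
  then obtain z where z: "\<And>E. E \<in> \<xi> \<Longrightarrow> good E (z E)" by metis
  define K where "K E = fst (z E)" for E
  define m where "m E = fst (snd (z E))" for E
  define r where "r E = snd (snd (z E))" for E
  have zE: "K E \<in> sets M" "measure M (space M - K E) < \<delta> / real (card \<xi>)" "0 < r E"
    "\<And>x y. x \<in> K E \<inter> E \<Longrightarrow> y \<in> K E - E \<Longrightarrow>
      \<exists>k. \<bar>k\<bar> \<le> int (m E) \<and> r E \<le> \<rho> (aut_power M T k x) (aut_power M T k y)" if "E \<in> \<xi>" for E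
    using z[OF that] unfolding good_def K_def m_def r_def by (simp_all add: case_prod_beta)
  define K0 where "K0 = (\<Inter>E\<in>\<xi>. K E)"
  have K0: "K0 \<in> sets M" unfolding K0_def using fin part_nonempty zE(1) by (intro sets.finite_INT) auto
  show thesis
  proof (rule that[OF K0])
    have "space M - K0 = (\<Union>E\<in>\<xi>. space M - K E)" by (auto simp: K0_def)
    then have "measure M (space M - K0) \<le> (\<Sum>E\<in>\<xi>. measure M (space M - K E))"
      using fin zE(1) by (simp only:) (intro finite_measure_subadditive_finite, auto)
    also have "\<dots> < (\<Sum>E\<in>\<xi>. \<delta> / real (card \<xi>))"
      using fin part_nonempty zE(2) by (intro sum_strict_mono) auto
    also have "\<dots> = \<delta>" using cpos by simp
    finally show "measure M (space M - K0) < \<delta>" .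
    show "0 < Min (r ` \<xi>)" using fin part_nonempty zE(3) by simp
    fix x y assume xy: "x \<in> K0" "y \<in> K0" "class_of \<xi> x \<noteq> class_of \<xi> y"
    have sp: "x \<in> space M" "y \<in> space M" using xy sets.sets_into_space[OF K0] by auto
    define E where "E = class_of \<xi> x"
    have E: "E \<in> \<xi>" "x \<in> E" unfolding E_def using class_of_in[OF pon sp(1)] by auto
    have "y \<notin> E" using class_of_unique[OF pon E(1), of y] xy(3) by (auto simp: E_def)
    have "x \<in> K E \<inter> E" "y \<in> K E - E" using xy E \<open>y \<notin> E\<close> by (auto simp: K0_def)
    from zE(4)[OF E(1) this] obtain k where
      k: "\<bar>k\<bar> \<le> int (m E)" "r E \<le> \<rho> (aut_power M T k x) (aut_power M T k y)" by blast
    have "Min (r ` \<xi>) \<le> r E" using fin E by simp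
    moreover have "m E \<le> (\<Sum>E\<in>\<xi>. m E)" using fin E by (intro member_le_sum) auto
    ultimately show "\<exists>k. \<bar>k\<bar> \<le> int (\<Sum>E\<in>\<xi>. m E) \<and>
        Min (r ` \<xi>) \<le> \<rho> (aut_power M T k x) (aut_power M T k y)"
      using k by (intro exI[of _ k]) linarith
  qed
qed

end

section \<open>Linear lower bound for the epsilon-entropy\<close>

definition hamming :: "nat \<Rightarrow> (nat \<Rightarrow> 'b) \<Rightarrow> (nat \<Rightarrow> 'b) \<Rightarrow> nat" where
  "hamming n v w = card {i. i < n \<and> v i \<noteq> w i}"

text \<open>\<open>t ^ hamming n v w\<close> is a product over coordinates, so the sum over words
  factorises. Each factor is at most \<open>1 + card A * t\<close>. After normalisation this is the
  weight of a product measure concentrated near \<open>w\<close>.\<close>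

lemma sum_power_hamming_le:
  fixes t :: real
  assumes fin: "finite A" and w: "w \<in> {..<n} \<rightarrow>\<^sub>E A" and t: "0 \<le> t"
  shows "(\<Sum>v\<in>{..<n} \<rightarrow>\<^sub>E A. t ^ hamming n v w) \<le> (1 + real (card A) * t) ^ n"
proof -
  have pow: "t ^ hamming n v w = (\<Prod>i<n. if v i = w i then 1 else t)" for v :: "nat \<Rightarrow> 'a"
  proof -
    have "{i. i < n \<and> v i \<noteq> w i} = {..<n} \<inter> - {i. v i = w i}" by auto
    then show ?thesis by (simp add: hamming_def prod.If_cases)
  qed
  have "(\<Sum>v\<in>{..<n} \<rightarrow>\<^sub>E A. t ^ hamming n v w) = (\<Prod>i<n. \<Sum>a\<in>A. if a = w i then 1 else t)"
    unfolding pow by (rule prod_sum_PiE[symmetric]) (auto simp: fin)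
  also have "\<dots> \<le> (\<Prod>i<n. 1 + real (card A) * t)"
  proof (intro prod_mono conjI)
    fix i assume "i \<in> {..<n}"
    then have wi: "w i \<in> A" using w by auto
    show "0 \<le> (\<Sum>a\<in>A. if a = w i then 1 else t)" using t by (intro sum_nonneg) auto
    have "(\<Sum>a\<in>A. if a = w i then 1 else t) \<le> (\<Sum>a\<in>A. (if a = w i then 1 else 0) + t)"
      using t by (intro sum_mono) auto
    also have "\<dots> = 1 + real (card A) * t"
      using fin wi by (simp add: sum.distrib)
    finally show "(\<Sum>a\<in>A. if a = w i then 1 else t) \<le> 1 + real (card A) * t" .
  qed
  finally show ?thesis by simp
qed

context mps_partition
begin

(* Gibbs' inequality against a mixture of the uniform distribution on names and of k product
   distributions concentrated around the names of representatives of the sets X j. *)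
lemma Hn_le_hamming_cover:
  assumes k: "1 \<le> k" and Z: "Z \<in> sets M" and t: "0 < t" "t \<le> 1" and \<theta>: "0 \<le> \<theta>"
    and cover: "space M - Z \<subseteq> (\<Union>j\<in>{1..k}. X j)"
    and close: "\<And>j x y. j \<in> {1..k} \<Longrightarrow> x \<in> X j \<inter> space M - Z \<Longrightarrow> y \<in> X j \<inter> space M - Z \<Longrightarrow>
      real (hamming n (name T \<xi> n x) (name T \<xi> n y)) \<le> \<theta> * real n"
  shows "Hn n \<le> log 2 (real (k + 1)) +
    real n * (log 2 (1 + real (card \<xi>) * t) + \<theta> * log 2 (1 / t)) + prob Z * (real n * log 2 (real (card \<xi>)))"
proof -
  define q where "q = real (card \<xi>)"
  have q: "1 \<le> q" using fin part_nonempty by (simp add: q_def Suc_le_eq card_gt_0_iff)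
  define W where "W = ({..<n} \<rightarrow>\<^sub>E \<xi>)"
  define V where "V = name T \<xi> n ` space M"
  have VW: "V \<subseteq> W" unfolding V_def W_def using name_in_words by auto
  have finW: "finite W" unfolding W_def by (rule finite_words)
  have finV: "finite V" using VW finW by (rule finite_subset)
  obtain x0 where x0: "x0 \<in> space M" using not_empty by blast
  \<comment> \<open>A cell that lies inside \<open>Z\<close> has no representative; the name of
    \<open>x0\<close> is a harmless default, because the estimate never appeals to such a
    cell.\<close>
  define w where "w j = (if X j \<inter> space M - Z = {} then name T \<xi> n x0
      else name T \<xi> n (SOME y. y \<in> X j \<inter> space M - Z))" for j
  have someX: "(SOME y. y \<in> X j \<inter> space M - Z) \<in> X j \<inter> space M - Z" if "X j \<inter> space M - Z \<noteq> {}" for j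
    using that by (metis all_not_in_conv someI)
  have wW: "w j \<in> W" for j
    unfolding w_def W_def using someX[of j] name_in_words[OF x0] name_in_words by auto
  have b: "0 < 1 + q * t" using q t by (simp add: add_pos_nonneg)
  \<comment> \<open>Equal shares \<open>1 / (k + 1)\<close> cost \<open>log 2 (k + 1)\<close>. The
    ball around \<open>w j\<close> serves names close to \<open>w j\<close>; the uniform part keeps
    \<open>Q\<close> positive and serves the names about which nothing is known.\<close>
  define Q where "Q v = (1 / q ^ n + (\<Sum>j=1..k. t ^ hamming n v (w j) / (1 + q * t) ^ n)) / real (k + 1)" for v
  have terms: "0 \<le> t ^ hamming n v (w j) / (1 + q * t) ^ n" for v j using t b by simp
  have Qunif: "1 / q ^ n / real (k + 1) \<le> Q v" for v
    unfolding Q_def using terms by (intro divide_right_mono) (auto intro: sum_nonneg)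
  have Qball: "t ^ hamming n v (w j) / (1 + q * t) ^ n / real (k + 1) \<le> Q v" if "j \<in> {1..k}" for v j
  proof -
    have "t ^ hamming n v (w j) / (1 + q * t) ^ n \<le> (\<Sum>j=1..k. t ^ hamming n v (w j) / (1 + q * t) ^ n)"
      using that terms by (intro member_le_sum) auto
    also have "\<dots> \<le> 1 / q ^ n + (\<Sum>j=1..k. t ^ hamming n v (w j) / (1 + q * t) ^ n)" using q by simp
    finally show ?thesis unfolding Q_def by (rule divide_right_mono) simp
  qed
  have Qpos: "0 < Q v" for v using less_le_trans[OF _ Qunif[of v]] q by simp
  have "(\<Sum>v\<in>W. Q v) \<le> 1"
  proof -
    have "(\<Sum>v\<in>W. 1 / q ^ n) = 1"
      unfolding W_def using q by (simp add: card_PiE q_def)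
    moreover have "(\<Sum>v\<in>W. \<Sum>j=1..k. t ^ hamming n v (w j) / (1 + q * t) ^ n) \<le> real k"
    proof -
      have "(\<Sum>v\<in>W. \<Sum>j=1..k. t ^ hamming n v (w j) / (1 + q * t) ^ n) =
          (\<Sum>j=1..k. (\<Sum>v\<in>W. t ^ hamming n v (w j)) / (1 + q * t) ^ n)"
        by (subst sum.swap) (simp add: sum_divide_distrib)
      also have "\<dots> \<le> (\<Sum>j=1..k. 1)"
      proof (rule sum_mono)
        fix j
        have "(\<Sum>v\<in>W. t ^ hamming n v (w j)) \<le> (1 + q * t) ^ n"
          unfolding W_def q_def using wW[of j] t fin by (intro sum_power_hamming_le) (auto simp: W_def)
        then show "(\<Sum>v\<in>W. t ^ hamming n v (w j)) / (1 + q * t) ^ n \<le> 1" using b by simp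
      qed
      finally show ?thesis by simp
    qed
    ultimately have "(\<Sum>v\<in>W. 1 / q ^ n + (\<Sum>j=1..k. t ^ hamming n v (w j) / (1 + q * t) ^ n)) \<le> real (k + 1)"
      by (simp add: sum.distrib)
    then show ?thesis unfolding Q_def sum_divide_distrib[symmetric] by simp
  qed
  then have sumQ: "(\<Sum>v\<in>V. Q v) \<le> 1"
    using sum_mono2[OF finW VW, of Q] Qpos by (meson less_imp_le order_trans)
  let ?P = "\<lambda>v. prob (cylinder M T \<xi> n v)"
  define a where "a = log 2 (real (k + 1)) + real n * (log 2 (1 + q * t) + \<theta> * log 2 (1 / t))"
  \<comment> \<open>A name outside \<open>B\<close> is realised by a point outside \<open>Z\<close>.
    That single point lies in some cell, so its name is within \<open>\<theta> * n\<close> of the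
    representative's name.\<close>
  define B where "B = {v \<in> V. cylinder M T \<xi> n v \<subseteq> Z}"
  have good: "- log 2 (Q v) \<le> a" if v: "v \<in> V - B" for v
  proof -
    obtain x where x: "x \<in> cylinder M T \<xi> n v" "x \<notin> Z" using v by (auto simp: B_def)
    then have xs: "x \<in> space M - Z" and nx: "v = name T \<xi> n x" by (auto simp: cylinder_def)
    then obtain j where j: "j \<in> {1..k}" "x \<in> X j" using cover by blast
    then have ne: "X j \<inter> space M - Z \<noteq> {}" using xs by blast
    define h where "h = hamming n v (w j)"
    have "real h \<le> \<theta> * real n"
      unfolding h_def nx w_def using ne someX[OF ne] j xs by (auto intro: close)
    moreover have lt: "log 2 t \<le> 0" using t by simp
    ultimately have h: "\<theta> * real n * log 2 t \<le> real h * log 2 t" by (intro mult_right_mono_neg)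
    have "log 2 (t ^ h / (1 + q * t) ^ n / real (k + 1)) \<le> log 2 (Q v)"
      using Qball[OF j(1), of v] t b Qpos[of v] by (subst log_le_cancel_iff) (auto simp: h_def)
    moreover have "log 2 (t ^ h / (1 + q * t) ^ n / real (k + 1)) =
        real h * log 2 t - real n * log 2 (1 + q * t) - log 2 (real (k + 1))"
      using t b by (simp add: log_divide log_mult log_nat_power)
    moreover have "log 2 (1 / t) = - log 2 t" using t by (simp add: log_divide)
    ultimately show ?thesis using h unfolding a_def by (simp add: algebra_simps)
  qed
  have bad: "- log 2 (Q v) \<le> log 2 (real (k + 1)) + real n * log 2 q" for v
  proof -
    have "log 2 (1 / q ^ n / real (k + 1)) \<le> log 2 (Q v)"
      using Qunif[of v] q Qpos[of v] by (subst log_le_cancel_iff) auto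
    moreover have "log 2 (1 / q ^ n / real (k + 1)) = - (real n * log 2 q) - log 2 (real (k + 1))"
      using q by (simp add: log_divide log_mult log_nat_power)
    ultimately show ?thesis by simp
  qed
  have a: "log 2 (real (k + 1)) \<le> a"
  proof -
    have "1 \<le> 1 + q * t" using q t by simp
    then have "0 \<le> log 2 (1 + q * t)" by (subst zero_le_log_cancel_iff) auto
    moreover have "0 \<le> log 2 (1 / t)" using t by simp
    ultimately have "0 \<le> real n * log 2 (1 + q * t) + (\<theta> * real n) * log 2 (1 / t)"
      using \<theta> by (intro add_nonneg_nonneg mult_nonneg_nonneg) auto
    then show ?thesis unfolding a_def by (simp add: algebra_simps)
  qed
  have lq: "0 \<le> real n * log 2 q" using q by simp
  have "Hn n \<le> - (\<Sum>v\<in>V. ?P v * log 2 (Q v))"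
    unfolding Hn_eq V_def[symmetric]
    using sumQ sum_prob_names[of n] Qpos by (intro gibbs_inequality finV) (auto simp: V_def)
  also have "\<dots> = (\<Sum>v\<in>V. ?P v * (- log 2 (Q v)))" by (simp add: sum_negf)
  \<comment> \<open>The uniform estimate adds at most \<open>n * log 2 q\<close>, and only on
    \<open>B\<close>, whose cylinders are disjoint subsets of \<open>Z\<close>.\<close>
  also have "\<dots> \<le> (\<Sum>v\<in>V. ?P v * a + (if v \<in> B then ?P v * (real n * log 2 q) else 0))"
  proof (rule sum_mono)
    fix v assume v: "v \<in> V"
    have "- log 2 (Q v) \<le> a + (if v \<in> B then real n * log 2 q else 0)"
      using good[of v] bad[of v] v a by auto
    then have "?P v * (- log 2 (Q v)) \<le> ?P v * (a + (if v \<in> B then real n * log 2 q else 0))"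
      by (intro mult_left_mono) auto
    then show "?P v * (- log 2 (Q v)) \<le> ?P v * a + (if v \<in> B then ?P v * (real n * log 2 q) else 0)"
      by (simp add: algebra_simps split: if_splits)
  qed
  also have "\<dots> = a + (\<Sum>v\<in>B. ?P v) * (real n * log 2 q)"
  proof -
    have "V \<inter> B = B" by (auto simp: B_def)
    then show ?thesis
      using finV sum_prob_names[of n]
      by (simp add: sum.distrib sum.If_cases sum_distrib_right[symmetric] V_def[symmetric])
  qed
  also have "\<dots> \<le> a + prob Z * (real n * log 2 q)"
  proof -
    have "(\<Sum>v\<in>B. ?P v) = prob (\<Union>v\<in>B. cylinder M T \<xi> n v)"
      by (rule sum_prob_cylinder) (auto simp: B_def V_def)
    also have "\<dots> \<le> prob Z" using Z by (intro finite_measure_mono) (auto simp: B_def)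
    finally show ?thesis using lq by (intro add_left_mono mult_right_mono)
  qed
  finally show ?thesis unfolding a_def q_def .
qed

end

text \<open>By invariance the orbit sum has mean \<open>n\<close> times the integral of
  \<open>f\<close>, so Markov's inequality gives a bound that is uniform in
  \<open>n\<close>.\<close>

lemma (in mps) birkhoff_sum_markov:
  fixes f :: "'a \<Rightarrow> real"
  assumes f: "integrable M f" and nonneg: "\<And>x. x \<in> space M \<Longrightarrow> 0 \<le> f x"
    and a: "0 < a" and n: "1 \<le> n"
  shows "{x \<in> space M. a * real n \<le> (\<Sum>k<n. f ((T ^^ k) x))} \<in> sets M"
    and "prob {x \<in> space M. a * real n \<le> (\<Sum>k<n. f ((T ^^ k) x))} \<le> (\<integral>x. f x \<partial>M) / a"
proof -
  have fm [measurable]: "f \<in> borel_measurable M" using f by simp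
  show "{x \<in> space M. a * real n \<le> (\<Sum>k<n. f ((T ^^ k) x))} \<in> sets M" by measurable
  have int: "integrable M (\<lambda>x. f ((T ^^ k) x))" for k
    using f iter_distr[of k] by (intro integrable_distr[OF iter_meas]) simp
  have eq: "(\<integral>x. f ((T ^^ k) x) \<partial>M) = (\<integral>x. f x \<partial>M)" for k
    using integral_distr[OF iter_meas fm, of k] iter_distr[of k] by simp
  have "prob {x \<in> space M. a * real n \<le> (\<Sum>k<n. f ((T ^^ k) x))} \<le>
      (\<integral>x. (\<Sum>k<n. f ((T ^^ k) x)) \<partial>M) / (a * real n)"
  proof (rule integral_Markov_inequality_measure[where A = "{}"])
    show "integrable M (\<lambda>x. \<Sum>k<n. f ((T ^^ k) x))" using int by (rule Bochner_Integration.integrable_sum)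
    show "AE x in M. 0 \<le> (\<Sum>k<n. f ((T ^^ k) x))"
      using nonneg iter_in_space by (intro AE_I2 sum_nonneg) auto
  qed (use a n in auto)
  also have "(\<integral>x. (\<Sum>k<n. f ((T ^^ k) x)) \<partial>M) = real n * (\<integral>x. f x \<partial>M)"
    using int by (simp add: eq)
  also have "real n * (\<integral>x. f x \<partial>M) / (a * real n) = (\<integral>x. f x \<partial>M) / a" using n by simp
  finally show "prob {x \<in> space M. a * real n \<le> (\<Sum>k<n. f ((T ^^ k) x))} \<le> (\<integral>x. f x \<partial>M) / a" .
qed

text \<open>Double counting: each \<open>i\<close> in \<open>R\<close> is charged to an index of its
  window \<open>[i - m, i + m]\<close>, and each index is charged at most \<open>2 * m + 1\<close>
  times. The margin of \<open>m\<close> on both sides keeps the windows inside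
  \<open>{..<n}\<close>.\<close>

lemma card_shifted_large_le:
  fixes a :: "nat \<Rightarrow> real"
  assumes nonneg: "\<And>l. 0 \<le> a l" and R: "R \<subseteq> {m..<n - m}"
    and large: "\<And>i. i \<in> R \<Longrightarrow> \<exists>k\<le>2 * m. r \<le> a (i - m + k)"
  shows "real (card R) * r \<le> real (2 * m + 1) * (\<Sum>l<n. a l)"
proof -
  have finR: "finite R" using R by (rule finite_subset) simp
  have "real (card R) * r = (\<Sum>i\<in>R. r)" by simp
  also have "\<dots> \<le> (\<Sum>i\<in>R. \<Sum>k\<le>2 * m. a (i - m + k))"
  proof (rule sum_mono)
    fix i assume "i \<in> R"
    then obtain k where k: "k \<le> 2 * m" "r \<le> a (i - m + k)" using large by blast
    have "a (i - m + k) \<le> (\<Sum>k\<le>2 * m. a (i - m + k))"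
      using k nonneg by (intro member_le_sum) auto
    then show "r \<le> (\<Sum>k\<le>2 * m. a (i - m + k))" using k by simp
  qed
  also have "\<dots> = (\<Sum>k\<le>2 * m. \<Sum>i\<in>R. a (i - m + k))" by (rule sum.swap)
  also have "\<dots> \<le> (\<Sum>k\<le>2 * m. \<Sum>l<n. a l)"
  proof (rule sum_mono)
    fix k assume k: "k \<in> {..2 * m}"
    have Rm: "m \<le> i \<and> i < n - m" if "i \<in> R" for i using R that by auto
    have inj: "inj_on (\<lambda>i. i - m + k) R"
    proof (rule inj_onI)
      fix i j assume "i \<in> R" "j \<in> R" "i - m + k = j - m + k"
      then show "i = j" using Rm[of i] Rm[of j] by linarith
    qed
    have "(\<Sum>i\<in>R. a (i - m + k)) = (\<Sum>l\<in>(\<lambda>i. i - m + k) ` R. a l)"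
      by (subst sum.reindex[OF inj]) simp
    also have "\<dots> \<le> (\<Sum>l<n. a l)"
    proof (rule sum_mono2)
      show "(\<lambda>i. i - m + k) ` R \<subseteq> {..<n}" 
      proof
        fix l assume "l \<in> (\<lambda>i. i - m + k) ` R"
        then obtain i where i: "i \<in> R" "l = i - m + k" by blast
        have "k \<le> 2 * m" using k by simp
        then show "l \<in> {..<n}" unfolding lessThan_iff using Rm[OF i(1)] i(2) by linarith
      qed
    qed (use nonneg in auto)
    finally show "(\<Sum>i\<in>R. a (i - m + k)) \<le> (\<Sum>l<n. a l)" .
  qed
  also have "\<dots> = real (2 * m + 1) * (\<Sum>l<n. a l)" by simp
  finally show ?thesis .
qed

text \<open>A disagreement of names lies within \<open>m\<close> of an end, or at a visit of one of
  the orbits outside \<open>K\<close>, or at a position whose window must contain a distance of at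
  least \<open>r\<close>. Indexing \<open>sep\<close> by the left end \<open>i\<close> of the window
  avoids truncated subtraction.\<close>

lemma hamming_name_le:
  fixes a :: "nat \<Rightarrow> real"
  assumes nonneg: "\<And>l. 0 \<le> a l" and r: "0 < r"
    and sep: "\<And>i. (T ^^ (i + m)) x \<in> K \<Longrightarrow> (T ^^ (i + m)) y \<in> K \<Longrightarrow>
      class_of \<xi> ((T ^^ (i + m)) x) \<noteq> class_of \<xi> ((T ^^ (i + m)) y) \<Longrightarrow> \<exists>k\<le>2 * m. r \<le> a (i + k)"
  shows "real (hamming n (name T \<xi> n x) (name T \<xi> n y)) \<le>
    2 * real m + real (card {i. i < n \<and> (T ^^ i) x \<notin> K}) + real (card {i. i < n \<and> (T ^^ i) y \<notin> K}) +
    real (2 * m + 1) / r * (\<Sum>l<n. a l)"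
proof -
  let ?d = "\<lambda>i. class_of \<xi> ((T ^^ i) x) \<noteq> class_of \<xi> ((T ^^ i) y)"
  define R where "R = {i \<in> {m..<n - m}. ?d i \<and> (T ^^ i) x \<in> K \<and> (T ^^ i) y \<in> K}"
  have "{i. i < n \<and> name T \<xi> n x i \<noteq> name T \<xi> n y i} \<subseteq>
      ({..<m} \<union> {n - m..<n}) \<union> ({i. i < n \<and> (T ^^ i) x \<notin> K} \<union> ({i. i < n \<and> (T ^^ i) y \<notin> K} \<union> R))"
    by (auto simp: name_def R_def)
  then have "hamming n (name T \<xi> n x) (name T \<xi> n y) \<le> card
      (({..<m} \<union> {n - m..<n}) \<union> ({i. i < n \<and> (T ^^ i) x \<notin> K} \<union> ({i. i < n \<and> (T ^^ i) y \<notin> K} \<union> R)))"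
    unfolding hamming_def by (intro card_mono) (auto simp: R_def)
  also have "\<dots> \<le> (card {..<m} + card {n - m..<n}) + (card {i. i < n \<and> (T ^^ i) x \<notin> K} +
      (card {i. i < n \<and> (T ^^ i) y \<notin> K} + card R))"
    by (intro order_trans[OF card_Un_le] add_mono card_Un_le order_refl)
  also have "\<dots> \<le> 2 * m + card {i. i < n \<and> (T ^^ i) x \<notin> K} + card {i. i < n \<and> (T ^^ i) y \<notin> K} + card R"
    by simp
  finally have "real (hamming n (name T \<xi> n x) (name T \<xi> n y)) \<le>
      2 * real m + real (card {i. i < n \<and> (T ^^ i) x \<notin> K}) + real (card {i. i < n \<and> (T ^^ i) y \<notin> K}) + real (card R)"
    by (simp only: of_nat_le_iff[where 'a = real, symmetric] of_nat_add of_nat_mult of_nat_numeral)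
  moreover have "real (card R) * r \<le> real (2 * m + 1) * (\<Sum>l<n. a l)"
  proof (rule card_shifted_large_le[OF nonneg])
    show "R \<subseteq> {m..<n - m}" by (auto simp: R_def)
    fix i assume "i \<in> R"
    then show "\<exists>k\<le>2 * m. r \<le> a (i - m + k)" using sep[of "i - m"] by (simp add: R_def)
  qed
  then have "real (card R) \<le> real (2 * m + 1) / r * (\<Sum>l<n. a l)" using r by (simp add: field_simps)
  ultimately show ?thesis by linarith
qed

section \<open>Transfer from names to averaged semimetrics\<close>

context aut_system
begin

lemma average_eq: "average M T n \<rho> x y = (\<Sum>k<n. \<rho> ((T ^^ k) x) ((T ^^ k) y)) / real n"
  by (simp add: average_def translate_def aut_power_eq)

lemma diameter_bound:
  assumes "semimetric_diameter f A < ennreal \<epsilon>" "x \<in> A" "y \<in> A" "0 < \<epsilon>"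
  shows "f x y < \<epsilon>"
proof -
  have "ennreal (f x y) \<le> semimetric_diameter f A"
    unfolding semimetric_diameter_def using assms(2,3) by (meson SUP_upper SUP_upper2 order_refl)
  then have "ennreal (f x y) < ennreal \<epsilon>" using assms(1) by (rule le_less_trans)
  then show ?thesis using assms(4) by (cases "0 \<le> f x y") (auto simp: ennreal_less_iff)
qed

lemma eps_entropy_lower:
  assumes "\<And>k. 1 \<le> k \<Longrightarrow> eps_partitionable M f \<epsilon> k \<Longrightarrow> c \<le> log 2 (real k)"
  shows "ereal c \<le> eps_entropy M f \<epsilon>"
proof (cases "\<exists>k\<ge>1. eps_partitionable M f \<epsilon> k")
  case True
  define k where "k = (LEAST k. 1 \<le> k \<and> eps_partitionable M f \<epsilon> k)"
  have "1 \<le> k \<and> eps_partitionable M f \<epsilon> k" unfolding k_def using True by (rule LeastI_ex)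
  then show ?thesis using assms True by (simp add: eps_entropy_def k_def)
qed (auto simp: eps_entropy_def)

text \<open>Budget in units of \<open>L * n / 8\<close>: the join entropy exceeds seven; ball size,
  Hamming radius and exceptional set take one each, and the additive constant takes one. Three
  remain for \<open>log 2 k\<close>, more than the two that are claimed. Neither this rate nor the
  threshold for \<open>n\<close> depends on the precision.\<close>

lemma linear_entropy_growth:
  assumes adm: "admissible M \<rho>" and gen: "generating M T \<rho>"
    and part: "finite_measurable_partition M \<xi>" and pos: "0 < ks_entropy_partition M T \<xi>"
  obtains \<epsilon>0 c :: real where "0 < \<epsilon>0" "0 < c"
    "\<And>\<epsilon>. 0 < \<epsilon> \<Longrightarrow> \<epsilon> \<le> \<epsilon>0 \<Longrightarrow> \<forall>\<^sub>F n in sequentially. ereal (c * real n) \<le> eps_entropy M (average M T n \<rho>) \<epsilon>"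
proof -
  interpret mps_partition M T \<xi> by unfold_locales (rule part)
  have ms: "semimetric_on (space M) \<rho>"
    using adm by (auto simp: admissible_def measurable_semimetric_def)
  define L where "L = ks_entropy_partition M T \<xi>"
  have L: "0 < L" using pos by (simp add: L_def)
  define q where "q = real (card \<xi>)"
  have q: "1 \<le> q" using fin part_nonempty by (simp add: q_def Suc_le_eq card_gt_0_iff)
  \<comment> \<open>Small enough that \<open>1 + q * t \<le> 2 powr (L / 8)\<close>, which caps the
    ball-size term, and capped by 1 so that \<open>log 2 (1 / t)\<close> is nonnegative.\<close>
  define t where "t = min 1 ((2 powr (L / 8) - 1) / q)"
  have "1 < 2 powr (L / 8)" using L by simp
  then have t: "0 < t" "t \<le> 1" using q by (auto simp: t_def)
  have "1 + q * t \<le> 2 powr (L / 8)"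
  proof -
    have "q * t \<le> q * ((2 powr (L / 8) - 1) / q)" using q by (intro mult_left_mono) (auto simp: t_def)
    then show ?thesis using q by simp
  qed
  then have logt: "log 2 (1 + q * t) \<le> L / 8"
    using q t by (subst log_le_iff) (auto simp: add_pos_pos)
  \<comment> \<open>The \<open>+ 1\<close> guards against a zero denominator when
    \<open>t = 1\<close>; in \<open>\<eta>\<close> below it does so when
    \<open>q = 1\<close>.\<close>
  define \<theta> where "\<theta> = (L / 8) / (log 2 (1 / t) + 1)"
  have lt: "0 \<le> log 2 (1 / t)" using t by simp
  have \<theta>: "0 < \<theta>" unfolding \<theta>_def using L lt by simp
  have \<theta>t: "\<theta> * log 2 (1 / t) \<le> L / 8"
    unfolding \<theta>_def using L lt by (simp add: field_simps)
  define \<eta> where "\<eta> = (L / 8) / (log 2 q + 1)"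
  have lq: "0 \<le> log 2 q" using q by simp
  have \<eta>: "0 < \<eta>" unfolding \<eta>_def using L lq by simp
  have \<eta>q: "\<eta> * log 2 q \<le> L / 8"
    unfolding \<eta>_def using L lq by (simp add: field_simps)
  \<comment> \<open>Markov's inequality at level \<open>\<theta> / 4\<close> turns this into an
    exceptional set of measure below \<open>\<eta> / 2\<close>.\<close>
  have "0 < \<eta> * \<theta> / 8" using \<eta> \<theta> by simp
  from generating_separates_partition[OF adm gen part this] obtain K m r where K: "K \<in> sets M"
    and mK: "measure M (space M - K) < \<eta> * \<theta> / 8" and r: "0 < r"
    and sepK: "\<And>x y. x \<in> K \<Longrightarrow> y \<in> K \<Longrightarrow> class_of \<xi> x \<noteq> class_of \<xi> y \<Longrightarrow>
       \<exists>k. \<bar>k\<bar> \<le> int m \<and> r \<le> \<rho> (aut_power M T k x) (aut_power M T k y)" by this blast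
  from invertible_core obtain G where G: "full_measure M G"
    and TG: "\<And>x. x \<in> G \<Longrightarrow> T x \<in> G" and STG: "\<And>x. x \<in> G \<Longrightarrow> S (T x) = x" by this blast
  have iterG: "(T ^^ i) x \<in> G" if "x \<in> G" for i x by (induction i) (use that TG in auto)
  have sepG: "\<exists>k\<le>2 * m. r \<le> \<rho> ((T ^^ (i + k)) x) ((T ^^ (i + k)) y)"
    if G2: "x \<in> G" "y \<in> G" and K2: "(T ^^ (i + m)) x \<in> K" "(T ^^ (i + m)) y \<in> K"
      "class_of \<xi> ((T ^^ (i + m)) x) \<noteq> class_of \<xi> ((T ^^ (i + m)) y)" for x y i
  proof -
    obtain k where k: "\<bar>k\<bar> \<le> int m"
      "r \<le> \<rho> (aut_power M T k ((T ^^ (i + m)) x)) (aut_power M T k ((T ^^ (i + m)) y))"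
      using sepK[OF K2] by blast
    have sh: "aut_power M T k ((T ^^ (i + m)) z) = (T ^^ (i + nat (int m + k))) z" if z: "z \<in> G" for z
    proof -
      have "(T ^^ (i + m)) z = (T ^^ m) ((T ^^ i) z)" by (subst add.commute) (simp add: funpow_add)
      then have "aut_power M T k ((T ^^ (i + m)) z) = (T ^^ nat (int m + k)) ((T ^^ i) z)"
        using aut_power_shift[of G, OF TG STG iterG[OF z] k(1)] by simp
      then show ?thesis by (subst add.commute) (simp add: funpow_add)
    qed
    have "nat (int m + k) \<le> 2 * m" using k(1) by linarith
    then show ?thesis using k(2) sh[OF G2(1)] sh[OF G2(2)] by auto
  qed
  \<comment> \<open>The first bound keeps \<open>X 0\<close> below the other half of
    \<open>\<eta>\<close>; the second makes the windowed distance sum at most a quarter of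
    \<open>\<theta> * n\<close>.\<close>
  define \<epsilon>0 where "\<epsilon>0 = min (\<eta> / 2) (\<theta> * r / (4 * real (2 * m + 1)))"
  have \<epsilon>0: "0 < \<epsilon>0" unfolding \<epsilon>0_def using \<eta> \<theta> r by simp
  have "\<forall>\<^sub>F n in sequentially. 7 / 8 * L < Hn n / real n"
    using Hn_tendsto L by (intro order_tendstoD(1)) (auto simp: L_def)
  \<comment> \<open>Large \<open>n\<close> turns the \<open>2 * m\<close> boundary letters into
    another quarter of \<open>\<theta> * n\<close> and the additive constant 1 into
    \<open>L / 8 * n\<close>. The last two quarters pay for the visits of \<open>x\<close> and of
    \<open>y\<close> outside \<open>K\<close>.\<close>
  moreover have "\<forall>\<^sub>F n in sequentially. real n \<ge> 8 * real m / \<theta> + 8 / L + 1"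
    by (rule eventually_compose_filterlim[OF eventually_ge_at_top filterlim_real_sequentially])
  ultimately have ev: "\<forall>\<^sub>F n in sequentially. 7 / 8 * L < Hn n / real n \<and> real n \<ge> 8 * real m / \<theta> + 8 / L + 1"
    by (rule eventually_conj)
  show thesis
  proof (rule that[OF \<epsilon>0])
    show "0 < L / 4" using L by simp
    fix \<epsilon> :: real assume \<epsilon>: "0 < \<epsilon>" "\<epsilon> \<le> \<epsilon>0"
    show "\<forall>\<^sub>F n in sequentially. ereal (L / 4 * real n) \<le> eps_entropy M (average M T n \<rho>) \<epsilon>"
      using ev
    proof (rule eventually_mono, elim conjE)
      fix n assume Hbig: "7 / 8 * L < Hn n / real n" and nbig: "real n \<ge> 8 * real m / \<theta> + 8 / L + 1"
      have n8: "8 * real m / \<theta> \<le> real n" "8 / L \<le> real n" "1 \<le> real n"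
      proof -
        have "0 \<le> 8 * real m / \<theta>" "0 \<le> 8 / L" using \<theta> L by auto
        then show "8 * real m / \<theta> \<le> real n" "8 / L \<le> real n" "1 \<le> real n" using nbig by linarith+
      qed
      have n1: "1 \<le> n" and npos: "0 < real n" using n8(3) by auto
      have m_small: "2 * real m \<le> \<theta> / 4 * real n" using n8(1) \<theta> by (simp add: field_simps)
      have L_big: "1 \<le> L / 8 * real n" using n8(2) L by (simp add: field_simps)
      let ?g = "indicator (space M - K) :: 'a \<Rightarrow> real"
      define B where "B = {x \<in> space M. \<theta> / 4 * real n \<le> (\<Sum>k<n. ?g ((T ^^ k) x))}"
      have gi: "integrable M ?g" using K by (simp add: emeasure_eq_measure)
      have B: "B \<in> sets M" and "prob B \<le> (\<integral>x. ?g x \<partial>M) / (\<theta> / 4)"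
        unfolding B_def using birkhoff_sum_markov[OF gi _ _ n1, of "\<theta> / 4"] \<theta> by auto
      then have "prob B \<le> prob (space M - K) / (\<theta> / 4)" using K by simp
      also have "\<dots> < \<eta> * \<theta> / 8 / (\<theta> / 4)" using mK \<theta> by (intro divide_strict_right_mono) auto
      also have "\<dots> = \<eta> / 2" using \<theta> by simp
      finally have pB: "prob B < \<eta> / 2" .
      have visits: "real (card {i. i < n \<and> (T ^^ i) x \<notin> K}) < \<theta> / 4 * real n" if "x \<in> space M" "x \<notin> B" for x
      proof -
        have "(\<Sum>k<n. ?g ((T ^^ k) x)) = (\<Sum>k<n. if (T ^^ k) x \<notin> K then 1 else 0)"
          using iter_in_space[OF that(1)] by (intro sum.cong) (auto simp: indicator_def)
        also have "\<dots> = real (card {i. i < n \<and> (T ^^ i) x \<notin> K})"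
          by (simp add: sum.If_cases Int_def lessThan_def conj_commute)
        finally show ?thesis using that by (simp add: B_def not_le)
      qed
      show "ereal (L / 4 * real n) \<le> eps_entropy M (average M T n \<rho>) \<epsilon>"
      proof (rule eps_entropy_lower)
        fix k assume k: "1 \<le> k" and "eps_partitionable M (average M T n \<rho>) \<epsilon> k"
        then obtain X where X: "\<And>j. j \<le> k \<Longrightarrow> X j \<in> sets M" and X_cover: "(\<Union>j\<le>k. X j) = space M"
          and X0: "measure M (X 0) < \<epsilon>"
          and diam: "\<And>j. j \<in> {1..k} \<Longrightarrow> semimetric_diameter (average M T n \<rho>) (X j) < ennreal \<epsilon>"
          unfolding eps_partitionable_def by blast
        define Z where "Z = X 0 \<union> (B \<union> (space M - G))"
        have GM: "G \<in> sets M" using G by (simp add: full_measure_def)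
        have Z: "Z \<in> sets M" unfolding Z_def using X[of 0] B GM by auto
        have "prob Z \<le> prob (X 0) + (prob B + prob (space M - G))"
          unfolding Z_def using X[of 0] B GM
          by (intro order_trans[OF measure_Un_le] add_left_mono measure_Un_le) auto
        then have pZ: "prob Z \<le> \<eta>"
          using X0 pB \<epsilon> full_measure_compl[OF G] by (simp add: \<epsilon>0_def)
        have "Hn n \<le> log 2 (real (k + 1)) +
          real n * (log 2 (1 + real (card \<xi>) * t) + \<theta> * log 2 (1 / t)) + prob Z * (real n * log 2 (real (card \<xi>)))"
        proof (rule Hn_le_hamming_cover[OF k Z t])
          show "0 \<le> \<theta>" using \<theta> by simp
          show "space M - Z \<subseteq> (\<Union>j\<in>{1..k}. X j)"
          proof
            fix x assume x: "x \<in> space M - Z"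
            then obtain j where "j \<le> k" "x \<in> X j" using X_cover by blast
            moreover have "x \<notin> X 0" using x by (auto simp: Z_def)
            ultimately have "j \<in> {1..k}" by (cases j) auto
            then show "x \<in> (\<Union>j\<in>{1..k}. X j)" using \<open>x \<in> X j\<close> by blast
          qed
          fix j x y assume j: "j \<in> {1..k}" and x: "x \<in> X j \<inter> space M - Z" and y: "y \<in> X j \<inter> space M - Z"
          have xy: "x \<in> space M" "y \<in> space M" "x \<notin> B" "y \<notin> B" "x \<in> G" "y \<in> G"
            using x y by (auto simp: Z_def)
          define a where "a l = \<rho> ((T ^^ l) x) ((T ^^ l) y)" for l
          have a: "0 \<le> a l" for l
            using ms iter_in_space[OF xy(1)] iter_in_space[OF xy(2)] by (auto simp: a_def semimetric_on_def)
          have "average M T n \<rho> x y < \<epsilon>" using diameter_bound[OF diam[OF j]] x y \<epsilon> by auto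
          then have "(\<Sum>l<n. a l) / real n < \<epsilon>" by (simp add: average_eq a_def)
          then have suma: "(\<Sum>l<n. a l) \<le> \<epsilon> * real n" using npos by (simp add: field_simps)
          have "real (2 * m + 1) / r * (\<Sum>l<n. a l) \<le> real (2 * m + 1) / r * (\<epsilon> * real n)"
            using suma r by (intro mult_left_mono) auto
          also have "\<dots> \<le> real (2 * m + 1) / r * (\<theta> * r / (4 * real (2 * m + 1)) * real n)"
            using \<epsilon> r by (intro mult_left_mono mult_right_mono) (auto simp: \<epsilon>0_def)
          also have "\<dots> = \<theta> / 4 * real n"
          proof -
            have *: "c / r * (\<theta> * r / (4 * c) * real n) = \<theta> / 4 * real n" if "0 < c" for c
              using r that by (simp add: field_simps)
            show ?thesis by (rule *) simp
          qed
          finally have close: "real (2 * m + 1) / r * (\<Sum>l<n. a l) \<le> \<theta> / 4 * real n" .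
          have "real (hamming n (name T \<xi> n x) (name T \<xi> n y)) \<le>
            2 * real m + real (card {i. i < n \<and> (T ^^ i) x \<notin> K}) + real (card {i. i < n \<and> (T ^^ i) y \<notin> K}) +
            real (2 * m + 1) / r * (\<Sum>l<n. a l)"
            using sepG[OF xy(5,6)] by (intro hamming_name_le[OF a r]) (auto simp: a_def)
          then show "real (hamming n (name T \<xi> n x) (name T \<xi> n y)) \<le> \<theta> * real n"
            using m_small visits[OF xy(1,3)] visits[OF xy(2,4)] close by linarith
        qed
        also have "\<dots> \<le> (1 + log 2 (real k)) + real n * (L / 8 + L / 8) + L / 8 * real n"
        proof (intro add_mono)
          have "log 2 (real (k + 1)) \<le> log 2 (2 * real k)" using k by (subst log_le_cancel_iff) auto
          also have "\<dots> = 1 + log 2 (real k)" using k by (simp add: log_mult)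
          finally show "log 2 (real (k + 1)) \<le> 1 + log 2 (real k)" .
          show "real n * (log 2 (1 + real (card \<xi>) * t) + \<theta> * log 2 (1 / t)) \<le> real n * (L / 8 + L / 8)"
            using logt \<theta>t by (intro mult_left_mono add_mono) (auto simp: q_def)
          have "prob Z * (real n * log 2 (real (card \<xi>))) \<le> \<eta> * (real n * log 2 (real (card \<xi>)))"
            using pZ lq by (intro mult_right_mono) (auto simp: q_def)
          also have "\<dots> = (\<eta> * log 2 q) * real n" by (simp add: q_def)
          also have "\<dots> \<le> L / 8 * real n" using \<eta>q by (intro mult_right_mono) auto
          finally show "prob Z * (real n * log 2 (real (card \<xi>))) \<le> L / 8 * real n" .
        qed
        finally have "Hn n \<le> 1 + log 2 (real k) + 3 / 8 * (L * real n)" by (simp add: algebra_simps)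
        moreover have "7 / 8 * (L * real n) < Hn n" using Hbig npos by (simp add: field_simps)
        moreover have "1 \<le> L * real n / 8" using L_big by simp
        ultimately have "3 / 8 * (L * real n) \<le> log 2 (real k)" by linarith
        moreover have "0 \<le> L * real n" using L by simp
        ultimately show "L / 4 * real n \<le> log 2 (real k)" by simp
      qed
    qed
  qed
qed

end

section \<open>Upper bound for the epsilon-entropy\<close>

lemma eps_entropy_le:
  assumes "1 \<le> k" "eps_partitionable M f \<epsilon> k"
  shows "eps_entropy M f \<epsilon> \<le> ereal (log 2 (real k))"
proof -
  define l where "l = (LEAST k. 1 \<le> k \<and> eps_partitionable M f \<epsilon> k)"
  have "1 \<le> l \<and> eps_partitionable M f \<epsilon> l" unfolding l_def using assms by (intro LeastI) auto
  moreover have "l \<le> k" unfolding l_def using assms by (intro Least_le) auto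
  ultimately have "log 2 (real l) \<le> log 2 (real k)" by (subst log_le_cancel_iff) auto
  then show ?thesis using assms by (auto simp: eps_entropy_def l_def)
qed

text \<open>The leftover set takes index 0, and indices beyond \<open>card V\<close> get empty
  cells, whose diameter is 0. The slack \<open>\<epsilon>' < \<epsilon>\<close> is needed because a
  supremum preserves only weak inequalities.\<close>

lemma eps_partitionableI:
  fixes C :: "'b \<Rightarrow> 'a set"
  assumes V: "finite V" "card V \<le> k"
    and C: "\<And>v. v \<in> V \<Longrightarrow> C v \<in> sets M" "disjoint_family_on C V"
    and rest: "measure M (space M - (\<Union>v\<in>V. C v)) < \<epsilon>"
    and diam: "\<And>v x y. v \<in> V \<Longrightarrow> x \<in> C v \<Longrightarrow> y \<in> C v \<Longrightarrow> f x y \<le> \<epsilon>'" and \<epsilon>: "\<epsilon>' < \<epsilon>" "0 < \<epsilon>"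
  shows "eps_partitionable M f \<epsilon> k"
proof -
  obtain h where h: "bij_betw h {0..<card V} V" using ex_bij_betw_nat_finite[OF V(1)] by blast
  have hV: "h i \<in> V" if "i < card V" for i using bij_betwE[OF h] that by auto
  have h_inj: "i = j" if "h i = h j" "i < card V" "j < card V" for i j
    using h that by (auto simp: bij_betw_def inj_on_def)
  have h_surj: "\<exists>i<card V. v = h i" if "v \<in> V" for v
    using h that unfolding bij_betw_def by (metis atLeastLessThan_iff image_iff)
  define X where "X j = (if j = 0 then space M - (\<Union>v\<in>V. C v)
    else if j - 1 < card V then C (h (j - 1)) else {})" for j
  have CX: "C v \<subseteq> space M" if "v \<in> V" for v using C(1)[OF that] by (rule sets.sets_into_space)
  have X_cell: "\<exists>v\<in>V. x \<in> C v \<and> v = h (j - 1) \<and> j - 1 < card V" if "x \<in> X j" "j \<noteq> 0" for x j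
    using that hV by (auto simp: X_def split: if_splits)
  show ?thesis
    unfolding eps_partitionable_def
  proof (intro exI[of _ X] conjI allI impI ballI)
    show "X j \<in> sets M" for j
      unfolding X_def using C(1) V(1) hV by auto
    show "disjoint_family_on X {..k}"
      unfolding disjoint_family_on_def
    proof (intro ballI impI)
      fix i j :: nat assume ij: "i \<noteq> j"
      have False if x: "x \<in> X i" "x \<in> X j" for x
      proof -
        have z: "x \<notin> C v" if "x \<in> X 0" "v \<in> V" for v using that by (auto simp: X_def)
        show False
        proof (cases "i = 0 \<or> j = 0")
          case True
          then show False using ij x z X_cell[OF x(1)] X_cell[OF x(2)] by metis
        next
          case False
          then have "i \<noteq> 0" "j \<noteq> 0" by auto
          then have "x \<in> C (h (i - 1))" "x \<in> C (h (j - 1))" "i - 1 < card V" "j - 1 < card V"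
            using X_cell[OF x(1)] X_cell[OF x(2)] by auto
          moreover from this have "h (i - 1) = h (j - 1)"
            using C(2) hV unfolding disjoint_family_on_def by blast
          ultimately have "i - 1 = j - 1" using h_inj by blast
          then show False using ij \<open>i \<noteq> 0\<close> \<open>j \<noteq> 0\<close> by simp
        qed
      qed
      then show "X i \<inter> X j = {}" by blast
    qed
    show "(\<Union>j\<le>k. X j) = space M"
    proof (intro equalityI subsetI)
      fix x assume "x \<in> (\<Union>j\<le>k. X j)"
      then obtain j where j: "x \<in> X j" by blast
      show "x \<in> space M"
      proof (cases "j = 0")
        case False
        then show ?thesis using X_cell[OF j] CX by blast
      qed (use j in \<open>simp add: X_def\<close>)
    next
      fix x assume x: "x \<in> space M"
      show "x \<in> (\<Union>j\<le>k. X j)"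
      proof (cases "x \<in> (\<Union>v\<in>V. C v)")
        case True
        then obtain v where v: "v \<in> V" "x \<in> C v" by blast
        then obtain i where i: "i < card V" "v = h i" using h_surj by blast
        then have "x \<in> X (Suc i)" using v by (simp add: X_def)
        moreover have "Suc i \<le> k" using i V by simp
        ultimately show ?thesis by blast
      next
        case False
        then have "x \<in> X 0" using x by (simp add: X_def)
        then show ?thesis by blast
      qed
    qed
    show "measure M (X 0) < \<epsilon>" using rest by (simp add: X_def)
    fix j assume j: "j \<in> {1..k}"
    have "semimetric_diameter f (X j) \<le> ennreal \<epsilon>'"
      unfolding semimetric_diameter_def
    proof (intro SUP_least ennreal_leI)
      fix x y assume xy: "x \<in> X j" "y \<in> X j"
      show "f x y \<le> \<epsilon>'" using X_cell[OF xy(1)] X_cell[OF xy(2)] j diam by fastforce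
    qed
    also have "\<dots> < ennreal \<epsilon>" using \<epsilon> by (simp add: ennreal_lessI)
    finally show "semimetric_diameter f (X j) < ennreal \<epsilon>" .
  qed
qed

text \<open>Finitely many \<open>\<delta>\<close>-balls around dense points miss only a small set.
  On that one remaining cell the diameter may be infinite, but passing through a base point
  \<open>x0\<close> bounds \<open>\<rho> x y\<close> by two values of an integrable function;
  \<open>b\<close> is this function cut off to the leftover set, and its integral vanishes in the
  limit by dominated convergence.\<close>

lemma finite_partition_small_diameter:
  assumes prob: "prob_space M" and complete: "complete_measure M"
    and adm: "admissible M \<rho>" and summable: "summable_semimetric M \<rho>" and \<delta>: "0 < \<delta>" and \<kappa>: "0 < \<kappa>"
  obtains \<xi> b where "finite_measurable_partition M \<xi>" "integrable M b"
    "\<And>x. x \<in> space M \<Longrightarrow> 0 \<le> b x" "(\<integral>x. b x \<partial>M) < \<kappa>"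
    "\<And>x y. x \<in> space M \<Longrightarrow> y \<in> space M \<Longrightarrow> class_of \<xi> x = class_of \<xi> y \<Longrightarrow> \<rho> x y \<le> 2 * \<delta> + b x + b y"
proof -
  interpret prob_space M by fact
  have ms: "semimetric_on (space M) \<rho>"
    and meas: "(\<lambda>(x, y). \<rho> x y) \<in> borel_measurable (completion (M \<Otimes>\<^sub>M M))"
    using adm by (auto simp: admissible_def measurable_semimetric_def)
  have tri: "\<rho> x z \<le> \<rho> x y + \<rho> y z" and sym: "\<rho> x y = \<rho> y x" and nonneg: "0 \<le> \<rho> x y"
    if "x \<in> space M" "y \<in> space M" "z \<in> space M" for x y z
    using ms that unfolding semimetric_on_def by blast+
  from admissible_dense_sequence[OF prob complete adm] obtain Y and d :: "nat \<Rightarrow> 'a"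
    where Y: "full_measure M Y" and d: "range d \<subseteq> Y"
    and dm: "\<And>i. \<rho> (d i) \<in> borel_measurable M"
    and dense: "\<And>x e. x \<in> Y \<Longrightarrow> 0 < e \<Longrightarrow> \<exists>i. \<rho> x (d i) < e" by this blast
  have dsp: "d i \<in> space M" for i using d full_measure_subset_space[OF Y] by auto
  have "AE x in M. integrable M (\<rho> x)"
    using AE_section_measurable(2)[OF prob complete meas] summable by (simp add: summable_semimetric_def)
  from full_measure_AE[OF this] obtain I where I: "full_measure M I" "\<And>x. x \<in> I \<Longrightarrow> integrable M (\<rho> x)"
    by this blast
  obtain x0 where "x0 \<in> I" using full_measure_nonempty[OF I(1)] by blast
  then have x0: "x0 \<in> space M" and f: "integrable M (\<rho> x0)"
    using full_measure_subset_space[OF I(1)] I(2) by auto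
  have fm [measurable]: "\<rho> x0 \<in> borel_measurable M" using f by simp
  define B where "B i = {x \<in> space M. \<rho> (d i) x < \<delta>}" for i
  have B [measurable]: "B i \<in> sets M" for i unfolding B_def using dm[of i] by measurable
  define U where "U N = (\<Union>i<N. B i)" for N
  have U [measurable]: "U N \<in> sets M" for N unfolding U_def by auto
  define g where "g N x = \<rho> x0 x * indicator (space M - U N) x" for N x
  have gm [measurable]: "g N \<in> borel_measurable M" for N unfolding g_def by measurable
  have g_nonneg: "0 \<le> g N x" if "x \<in> space M" for N x using nonneg[OF x0 that x0] by (simp add: g_def)
  have gi: "integrable M (g N)" for N
    unfolding g_def using f by (intro integrable_real_mult_indicator) auto
  have "(\<lambda>N. \<integral>x. g N x \<partial>M) \<longlonglongrightarrow> (\<integral>x. 0 \<partial>M)"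
  proof (rule integral_dominated_convergence[where w = "\<rho> x0"])
    have "AE x in M. x \<in> Y" using Y by (simp add: full_measure_def)
    then show "AE x in M. (\<lambda>N. g N x) \<longlonglongrightarrow> 0"
    proof eventually_elim
      case (elim x)
      then have xs: "x \<in> space M" using full_measure_subset_space[OF Y] by blast
      obtain i where "\<rho> x (d i) < \<delta>" using dense[OF elim \<delta>] by blast
      then have "x \<in> B i" using xs sym[OF xs dsp xs] by (simp add: B_def)
      then have "x \<in> U N" if "i < N" for N using that by (auto simp: U_def)
      then have "\<forall>N>i. g N x = 0" by (simp add: g_def)
      then have "\<forall>\<^sub>F N in sequentially. g N x = 0"
        by (intro eventually_mono[OF eventually_gt_at_top[of i]]) blast
      then show ?case by (rule tendsto_eventually)
    qed
    show "AE x in M. norm (g N x) \<le> \<rho> x0 x" for N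
      using nonneg[OF x0 _ x0] by (intro AE_I2) (auto simp: g_def indicator_def)
  qed (auto simp: f)
  then have "\<forall>\<^sub>F N in sequentially. (\<integral>x. g N x \<partial>M) < \<kappa>"
    using \<kappa> by (intro order_tendstoD(2)) auto
  then obtain N where N: "(\<integral>x. g N x \<partial>M) < \<kappa>" by (auto simp: eventually_sequentially)
  \<comment> \<open>Placing the whole space at index \<open>N\<close> makes the last disjointed cell
    exactly the complement of the first \<open>N\<close> balls.\<close>
  define B' where "B' i = (if i < N then B i else space M)" for i
  define cell where "cell = disjointed B'"
  define \<xi> where "\<xi> = cell ` {..N} - {{}}"
  have B': "B' i \<in> sets M" for i by (simp add: B'_def)
  have cellM: "cell i \<in> sets M" for i 
    using sets.range_disjointed_sets[of B' M] B' by (auto simp: cell_def)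
  have cells: "(\<Union>i\<in>{0..<Suc N}. cell i) = space M"
    unfolding cell_def finite_UN_disjointed_eq
  proof
    show "(\<Union>i\<in>{0..<Suc N}. B' i) \<subseteq> space M" using sets.sets_into_space[OF B'] by blast
    have "B' N = space M" by (simp add: B'_def)
    then show "space M \<subseteq> (\<Union>i\<in>{0..<Suc N}. B' i)" by auto
  qed
  have pon: "partition_on (space M) \<xi>"
  proof (rule partition_onI)
    have "\<Union>(S - {{}}) = \<Union>S" for S :: "'a set set" by auto
    then have "\<Union>\<xi> = (\<Union>i\<in>{..N}. cell i)" by (simp add: \<xi>_def)
    also have "{..N} = {0..<Suc N}" by auto
    finally show "\<Union>\<xi> = space M" using cells by simp
    show "{} \<notin> \<xi>" by (simp add: \<xi>_def)
    fix P Q assume PQ: "P \<in> \<xi>" "Q \<in> \<xi>" "P \<noteq> Q"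
    then obtain i j where ij: "P = cell i" "Q = cell j" "i \<noteq> j" by (auto simp: \<xi>_def)
    show "disjnt P Q"
      unfolding ij(1,2) disjnt_def using disjoint_family_disjointed[of B'] ij(3)
      by (auto simp: cell_def disjoint_family_on_def)
  qed
  have part: "finite_measurable_partition M \<xi>"
    unfolding finite_measurable_partition_def using pon cellM by (auto simp: \<xi>_def)
  show thesis
  proof (rule that[OF part gi[of N] _ N])
    show "0 \<le> g N x" if "x \<in> space M" for x using g_nonneg[OF that] .
    fix x y assume xy: "x \<in> space M" "y \<in> space M" "class_of \<xi> x = class_of \<xi> y"
    have "x \<in> class_of \<xi> x" "y \<in> class_of \<xi> x" "class_of \<xi> x \<in> \<xi>"
      using class_of_in[OF pon xy(1)] class_of_in[OF pon xy(2)] xy(3) by auto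
    then obtain i where i: "i \<le> N" "x \<in> cell i" "y \<in> cell i" by (auto simp: \<xi>_def)
    show "\<rho> x y \<le> 2 * \<delta> + g N x + g N y"
    proof (cases "i < N")
      case True
      have "cell i \<subseteq> B' i" unfolding cell_def by (rule disjointed_subset)
      then have "x \<in> B i" "y \<in> B i" using i True by (auto simp: B'_def)
      then have "\<rho> (d i) x < \<delta>" "\<rho> (d i) y < \<delta>" by (auto simp: B_def)
      then have "\<rho> x y \<le> 2 * \<delta>"
        using tri[OF xy(1) dsp xy(2), of i] sym[OF xy(1) dsp xy(1), of i] by linarith
      then show ?thesis using g_nonneg[OF xy(1), of N] g_nonneg[OF xy(2), of N] by linarith
    next
      case False
      then have "i = N" using i by simp
      then have "z \<notin> U N" if "z \<in> cell i" for z
        using that by (auto simp: cell_def disjointed_def U_def B'_def)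
      then have "g N x = \<rho> x0 x" "g N y = \<rho> x0 y" using i xy by (auto simp: g_def)
      then show ?thesis
        using tri[OF xy(1) x0 xy(2)] sym[OF xy(1) x0 xy(1)] \<delta> by linarith
    qed
  qed
qed

context aut_system
begin

text \<open>Minus the logarithm of the probability of the cylinder has mean \<open>Hn n\<close>.
  Names of probability below \<open>2 powr (- L)\<close> thus carry mass at most
  \<open>Hn n / L\<close>, and at most \<open>2 powr L\<close> names are left.\<close>

lemma eps_entropy_average_le:
  assumes adm: "admissible M \<rho>" and summable: "summable_semimetric M \<rho>" and \<epsilon>: "0 < \<epsilon>"
  obtains \<xi> where "finite_measurable_partition M \<xi>"
    "\<And>n. 1 \<le> n \<Longrightarrow> eps_entropy M (average M T n \<rho>) \<epsilon> \<le>
      ereal (2 * (partition_entropy M (iterated_join M T \<xi> n) + 1) / \<epsilon>)"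
proof -
  \<comment> \<open>With equal names the averaged distance is at most \<open>\<epsilon> / 4\<close>
    plus two orbit averages of \<open>b\<close>. Outside \<open>Z\<close> each of these is below
    \<open>\<epsilon> / 8\<close>, and the integral bound
    \<open>\<epsilon> * \<epsilon> / 32\<close> gives
    \<open>prob Z \<le> \<epsilon> / 4\<close>.\<close>
  have "0 < \<epsilon> / 8" "0 < \<epsilon> * \<epsilon> / 32" using \<epsilon> by auto
  from finite_partition_small_diameter[OF prob_space_axioms complete adm summable this] obtain \<xi> b
    where part: "finite_measurable_partition M \<xi>" and bi: "integrable M b"
      and b0: "\<And>x. x \<in> space M \<Longrightarrow> 0 \<le> b x" and b_int: "(\<integral>x. b x \<partial>M) < \<epsilon> * \<epsilon> / 32"
      and close: "\<And>x y. x \<in> space M \<Longrightarrow> y \<in> space M \<Longrightarrow> class_of \<xi> x = class_of \<xi> y \<Longrightarrow>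
        \<rho> x y \<le> 2 * (\<epsilon> / 8) + b x + b y" by this blast
  interpret mps_partition M T \<xi> by unfold_locales (rule part)
  show thesis
  proof (rule that[OF part])
    fix n :: nat assume n: "1 \<le> n"
    have npos: "0 < real n" using n by simp
    let ?P = "\<lambda>v. prob (cylinder M T \<xi> n v)"
    define V where "V = name T \<xi> n ` space M"
    \<comment> \<open>Chosen so that \<open>Hn n / L < \<epsilon> / 2\<close>; the
      \<open>+ 1\<close> keeps \<open>L\<close> positive when \<open>Hn n = 0\<close>.\<close>
    define L where "L = 2 * (Hn n + 1) / \<epsilon>"
    have L: "0 < L" unfolding L_def using Hn_nonneg[of n] \<epsilon> by (intro divide_pos_pos) auto
    define Z where "Z = {x \<in> space M. \<epsilon> / 8 * real n \<le> (\<Sum>k<n. b ((T ^^ k) x))}"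
    have Z: "Z \<in> sets M" and "prob Z \<le> (\<integral>x. b x \<partial>M) / (\<epsilon> / 8)"
      unfolding Z_def using birkhoff_sum_markov[OF bi b0 _ n, of "\<epsilon> / 8"] \<epsilon> by auto
    moreover have "(\<integral>x. b x \<partial>M) / (\<epsilon> / 8) \<le> (\<epsilon> * \<epsilon> / 32) / (\<epsilon> / 8)"
      using b_int \<epsilon> by (intro divide_right_mono) auto
    moreover have "(\<epsilon> * \<epsilon> / 32) / (\<epsilon> / 8) = \<epsilon> / 4" using \<epsilon> by simp
    ultimately have pZ: "prob Z \<le> \<epsilon> / 4" by linarith
    define A where "A = {v \<in> V. 2 powr (- L) \<le> ?P v}"
    have finV: "finite V" unfolding V_def by (rule finite_names)
    have finA: "finite A" using finV by (simp add: A_def)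
    have "real (card A) * 2 powr (- L) = (\<Sum>v\<in>A. 2 powr (- L))" by simp
    also have "\<dots> \<le> (\<Sum>v\<in>A. ?P v)" by (intro sum_mono) (simp add: A_def)
    also have "\<dots> \<le> (\<Sum>v\<in>V. ?P v)" using finV by (intro sum_mono2) (auto simp: A_def)
    also have "\<dots> = 1" unfolding V_def by (rule sum_prob_names)
    finally have cardA: "real (card A) \<le> 2 powr L" by (simp add: powr_minus field_simps)
    \<comment> \<open>The entropy counts at least one cell, while for large
      \<open>\<epsilon>\<close> the set \<open>A\<close> can be empty.\<close>
    define k where "k = max 1 (card A)"
    have "real k \<le> 2 powr L" using cardA L by (auto simp: k_def max_def ge_one_powr_ge_zero)
    then have logk: "log 2 (real k) \<le> L" by (subst log_le_iff) (auto simp: k_def)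
    have terms: "0 \<le> - (?P v * log 2 (?P v))" for v
    proof (cases "?P v = 0")
      case False
      then have "0 < ?P v" by (simp add: less_le)
      then have "log 2 (?P v) \<le> 0" using prob_le_1[of "cylinder M T \<xi> n v"] by simp
      then show ?thesis by (simp add: mult_nonneg_nonpos)
    qed simp
    have "(\<Sum>v\<in>V - A. ?P v) * L \<le> Hn n"
    proof -
      have "(\<Sum>v\<in>V - A. ?P v) * L = (\<Sum>v\<in>V - A. ?P v * L)" by (rule sum_distrib_right)
      also have "\<dots> \<le> (\<Sum>v\<in>V - A. - (?P v * log 2 (?P v)))"
      proof (rule sum_mono)
        fix v assume "v \<in> V - A"
        then have v: "?P v < 2 powr (- L)" by (auto simp: A_def)
        show "?P v * L \<le> - (?P v * log 2 (?P v))"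
        proof (cases "?P v = 0")
          case False
          then have pos: "0 < ?P v" by (simp add: less_le)
          then have "log 2 (?P v) \<le> - L" using v by (subst log_le_iff) auto
          then have "?P v * log 2 (?P v) \<le> ?P v * (- L)" by (intro mult_left_mono) auto
          then show ?thesis by simp
        qed simp
      qed
      also have "\<dots> \<le> (\<Sum>v\<in>V. - (?P v * log 2 (?P v)))" using finV terms by (intro sum_mono2) auto
      also have "\<dots> = Hn n" by (simp add: Hn_eq V_def sum_negf)
      finally show ?thesis .
    qed
    then have "(\<Sum>v\<in>V - A. ?P v) \<le> Hn n / L" using L by (simp add: field_simps)
    also have "\<dots> < \<epsilon> / 2" using Hn_nonneg[of n] \<epsilon> by (simp add: L_def field_simps)
    finally have low: "(\<Sum>v\<in>V - A. ?P v) < \<epsilon> / 2" .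
    have "eps_partitionable M (average M T n \<rho>) \<epsilon> k"
    proof (rule eps_partitionableI[where V = A and C = "\<lambda>v. cylinder M T \<xi> n v - Z"])
      show "finite A" by (rule finA)
      show "card A \<le> k" by (simp add: k_def)
      show "cylinder M T \<xi> n v - Z \<in> sets M" for v using Z by auto
      show "disjoint_family_on (\<lambda>v. cylinder M T \<xi> n v - Z) A"
        by (auto simp: disjoint_family_on_def cylinder_def)
      have UN: "(\<Union>v\<in>V - A. cylinder M T \<xi> n v) \<in> sets M" using finV by auto
      have "space M - (\<Union>v\<in>A. cylinder M T \<xi> n v - Z) \<subseteq> Z \<union> (\<Union>v\<in>V - A. cylinder M T \<xi> n v)"
        by (auto simp: cylinder_def V_def)
      then have "prob (space M - (\<Union>v\<in>A. cylinder M T \<xi> n v - Z)) \<le> prob (Z \<union> (\<Union>v\<in>V - A. cylinder M T \<xi> n v))"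
        using Z UN by (intro finite_measure_mono) auto
      also have "\<dots> \<le> prob Z + prob (\<Union>v\<in>V - A. cylinder M T \<xi> n v)" using Z UN by (intro measure_Un_le)
      also have "prob (\<Union>v\<in>V - A. cylinder M T \<xi> n v) = (\<Sum>v\<in>V - A. ?P v)"
        by (rule sum_prob_cylinder[symmetric]) (auto simp: V_def)
      finally show "prob (space M - (\<Union>v\<in>A. cylinder M T \<xi> n v - Z)) < \<epsilon>" using pZ low \<epsilon> by linarith
      show "\<epsilon> / 2 < \<epsilon>" "0 < \<epsilon>" using \<epsilon> by auto
      fix v x y assume "x \<in> cylinder M T \<xi> n v - Z" "y \<in> cylinder M T \<xi> n v - Z"
      then have xy: "x \<in> space M" "y \<in> space M" "x \<notin> Z" "y \<notin> Z" and nm: "name T \<xi> n x = name T \<xi> n y"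
        by (auto simp: cylinder_def)
      have "class_of \<xi> ((T ^^ k) x) = class_of \<xi> ((T ^^ k) y)" if "k < n" for k
        using fun_cong[OF nm, of k] that by (simp add: name_def)
      then have "(\<Sum>k<n. \<rho> ((T ^^ k) x) ((T ^^ k) y)) \<le> (\<Sum>k<n. 2 * (\<epsilon> / 8) + b ((T ^^ k) x) + b ((T ^^ k) y))"
        using iter_in_space xy by (intro sum_mono close) auto
      also have "\<dots> = \<epsilon> / 4 * real n + (\<Sum>k<n. b ((T ^^ k) x)) + (\<Sum>k<n. b ((T ^^ k) y))"
        by (simp add: sum.distrib)
      also have "\<dots> \<le> \<epsilon> / 2 * real n" using xy by (simp add: Z_def)
      finally show "average M T n \<rho> x y \<le> \<epsilon> / 2" using npos by (simp add: average_eq field_simps)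
    qed
    then have "eps_entropy M (average M T n \<rho>) \<epsilon> \<le> ereal (log 2 (real k))"
      by (intro eps_entropy_le) (simp_all add: k_def)
    also have "\<dots> \<le> ereal L" using logk by simp
    finally show "eps_entropy M (average M T n \<rho>) \<epsilon> \<le>
      ereal (2 * (partition_entropy M (iterated_join M T \<xi> n) + 1) / \<epsilon>)" by (simp add: L_def Hn_def)
  qed
qed

end

section \<open>Scaling entropy sequences\<close>

context aut_system
begin

text \<open>The metric of the real line pulled back by an almost everywhere injective coordinate.
  Passing through \<open>arctan\<close> bounds it, hence makes it summable, and it separates points
  already at \<open>k = 0\<close>.\<close>

lemma pullback_metric:
  obtains \<rho> where "admissible M \<rho>" "summable_semimetric M \<rho>" "generating M T \<rho>"
proof -
  from standard_compact_approximation[OF std] obtain g :: "'a \<Rightarrow> real" and A where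
    A: "full_measure M A" and inj: "inj_on g A" and g: "g \<in> borel_measurable (restrict_space M A)" by this blast
  define h where "h x = (if x \<in> A then arctan (g x) else 0)" for x
  define \<rho> where "\<rho> x y = \<bar>h x - h y\<bar>" for x y
  have Asp: "A \<subseteq> space M" by (rule full_measure_subset_space[OF A])
  have "{x \<in> space M. x \<in> A} = A" using Asp by auto
  then have h [measurable]: "h \<in> borel_measurable M"
    unfolding h_def using A g by (subst measurable_If_restrict_space_iff) (auto simp: full_measure_def)
  interpret P: pair_prob_space M M ..
  have m: "(\<lambda>(x, y). \<rho> x y) \<in> borel_measurable (M \<Otimes>\<^sub>M M)"
    unfolding \<rho>_def by measurable
  have "measurable_semimetric M \<rho>"
    unfolding measurable_semimetric_def semimetric_on_def
  proof (intro conjI ballI)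
    show "(\<lambda>(x, y). \<rho> x y) \<in> borel_measurable (completion (M \<Otimes>\<^sub>M M))"
      by (rule measurable_completion[OF m])
  qed (auto simp: \<rho>_def)
  moreover have "semimetric_separable (space M) \<rho>"
  proof -
    obtain D where D: "countable D" "D \<subseteq> h ` space M" "h ` space M \<subseteq> closure D"
      using separable[of "h ` space M"] by blast
    show ?thesis
      unfolding semimetric_separable_def
    proof (intro exI[of _ "inv_into (space M) h ` D"] conjI ballI allI impI)
      show "countable (inv_into (space M) h ` D)" using D(1) by simp
      show "inv_into (space M) h ` D \<subseteq> space M" using D(2) by (auto intro: inv_into_into)
      fix x and e :: real assume "x \<in> space M" "0 < e"
      then obtain t where "t \<in> D" "dist t (h x) < e"
        using D(3) closure_approachable[of "h x" D] by blast
      then show "\<exists>d\<in>inv_into (space M) h ` D. \<rho> x d < e"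
        using D(2) by (auto simp: \<rho>_def f_inv_into_f dist_real_def abs_minus_commute intro!: bexI[of _ t])
    qed
  qed
  moreover have "full_measure M (space M)" by (simp add: full_measure_def)
  ultimately have adm: "admissible M \<rho>" unfolding admissible_def by blast
  have h_bound: "\<bar>h x\<bar> \<le> pi / 2" for x
    using arctan_bounded[of "g x"] by (auto simp: h_def abs_le_iff)
  have "norm (\<rho> x y) \<le> pi" for x y
    using h_bound[of x] h_bound[of y] unfolding \<rho>_def real_norm_def by linarith
  then have "integrable (M \<Otimes>\<^sub>M M) (\<lambda>(x, y). \<rho> x y)"
    by (intro P.integrable_const_bound[where B = pi]) (auto simp: m)
  then have sm: "summable_semimetric M \<rho>"
    unfolding summable_semimetric_def using integrable_completion[OF m] by simp
  have "generating M T \<rho>"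
    unfolding generating_def
  proof (intro exI[of _ A] conjI A ballI impI)
    fix x y assume xy: "x \<in> A" "y \<in> A" "x \<noteq> y"
    then have "arctan (g x) \<noteq> arctan (g y)"
      using inj arctan_eq_iff unfolding inj_on_def by blast
    then have "0 < translate M T 0 \<rho> x y" using xy by (simp add: translate_def aut_power_eq \<rho>_def h_def)
    then show "\<exists>k. 0 < translate M T k \<rho> x y" by blast
  qed
  then show thesis using adm sm by (intro that)
qed

lemma ks_entropy_partition_nonneg:
  assumes "finite_measurable_partition M \<xi>"
  shows "0 \<le> ks_entropy_partition M T \<xi>"
proof -
  interpret mps_partition M T \<xi> by unfold_locales fact
  show ?thesis using Hn_tendsto by (rule LIMSEQ_le_const) (auto simp: Hn_nonneg)
qed

lemma trivial_partition: "finite_measurable_partition M {space M}"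
  using not_empty by (auto simp: finite_measurable_partition_def partition_on_def)

text \<open>The values on partitions are nonnegative, so their supremum vanishes only if each does;
  the trivial partition keeps the supremum from being taken over the empty set.\<close>

lemma ks_entropy_zero_iff:
  "ks_entropy M T = 0 \<longleftrightarrow> (\<forall>\<xi>. finite_measurable_partition M \<xi> \<longrightarrow> ks_entropy_partition M T \<xi> = 0)"
proof
  assume "ks_entropy M T = 0"
  then have "ks_entropy_partition M T \<xi> \<le> 0" if "finite_measurable_partition M \<xi>" for \<xi>
    using SUP_upper[of \<xi> "{\<xi>. finite_measurable_partition M \<xi>}" "\<lambda>\<xi>. ereal (ks_entropy_partition M T \<xi>)"] that
    by (simp add: ks_entropy_def)
  then show "\<forall>\<xi>. finite_measurable_partition M \<xi> \<longrightarrow> ks_entropy_partition M T \<xi> = 0"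
    using ks_entropy_partition_nonneg by (meson order_antisym)
next
  assume "\<forall>\<xi>. finite_measurable_partition M \<xi> \<longrightarrow> ks_entropy_partition M T \<xi> = 0"
  then have "ks_entropy M T = (SUP \<xi>\<in>{\<xi>. finite_measurable_partition M \<xi>}. 0)"
    unfolding ks_entropy_def by (intro SUP_cong) auto
  also have "\<dots> = 0" using trivial_partition by (intro cSUP_const) auto
  finally show "ks_entropy M T = 0" .
qed

lemma positive_partition:
  assumes "ks_entropy M T \<noteq> 0"
  obtains \<xi> where "finite_measurable_partition M \<xi>" "0 < ks_entropy_partition M T \<xi>"
  using assms ks_entropy_partition_nonneg unfolding ks_entropy_zero_iff by (metis order_le_less)

lemma partition_entropy_tendsto:
  assumes "finite_measurable_partition M \<xi>"
  shows "(\<lambda>n. partition_entropy M (iterated_join M T \<xi> n) / real n) \<longlonglongrightarrow> ks_entropy_partition M T \<xi>"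
proof -
  interpret mps_partition M T \<xi> by unfold_locales fact
  show ?thesis using Hn_tendsto by (simp add: Hn_def)
qed

lemma scaled_entropy_tendsto:
  assumes "finite_measurable_partition M \<xi>"
  shows "(\<lambda>n. 2 * (partition_entropy M (iterated_join M T \<xi> n) + 1) / \<epsilon> / real n)
    \<longlonglongrightarrow> 2 * ks_entropy_partition M T \<xi> / \<epsilon>"
proof -
  have "(\<lambda>n. 2 / \<epsilon> * (partition_entropy M (iterated_join M T \<xi> n) / real n + 1 / real n))
      \<longlonglongrightarrow> 2 / \<epsilon> * (ks_entropy_partition M T \<xi> + 0)"
    by (intro tendsto_intros partition_entropy_tendsto[OF assms] lim_1_over_n)
  moreover have "2 / \<epsilon> * (a / real n + 1 / real n) = 2 * (a + 1) / \<epsilon> / real n" for a :: real and n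
    by (simp add: add_divide_distrib[symmetric])
  ultimately show ?thesis by simp
qed

text \<open>The upper constant comes from a partition chosen for each precision, which the
  definition of a scaling sequence permits; the lower constant comes from one partition of positive
  entropy.\<close>

lemma linear_scaling_entropy_sequence:
  assumes "ks_entropy M T \<noteq> 0"
  shows "scaling_entropy_sequence M T real"
proof -
  from pullback_metric obtain \<rho> where adm: "admissible M \<rho>" and sm: "summable_semimetric M \<rho>"
    and gen: "generating M T \<rho>" by this blast
  from positive_partition[OF assms] obtain \<xi> where
    "finite_measurable_partition M \<xi>" "0 < ks_entropy_partition M T \<xi>" by this blast
  from linear_entropy_growth[OF adm gen this] obtain \<epsilon>0 c :: real where \<epsilon>0: "0 < \<epsilon>0" and c: "0 < c"
    and growth: "\<And>\<epsilon>. 0 < \<epsilon> \<Longrightarrow> \<epsilon> \<le> \<epsilon>0 \<Longrightarrow>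
      \<forall>\<^sub>F n in sequentially. ereal (c * real n) \<le> eps_entropy M (average M T n \<rho>) \<epsilon>" by this blast
  have "scaling_sequence M T \<rho> real"
    unfolding scaling_sequence_def
  proof (intro conjI allI impI)
    show "0 < real n" if "1 \<le> n" for n using that by simp
    fix \<epsilon> :: real assume "0 < \<epsilon>"
    from eps_entropy_average_le[OF adm sm this] obtain \<eta> where \<eta>: "finite_measurable_partition M \<eta>"
      and le: "\<And>n. 1 \<le> n \<Longrightarrow> eps_entropy M (average M T n \<rho>) \<epsilon> \<le>
        ereal (2 * (partition_entropy M (iterated_join M T \<eta> n) + 1) / \<epsilon>)" by this blast
    define l where "l = 2 * ks_entropy_partition M T \<eta> / \<epsilon> + 1"
    have "\<forall>\<^sub>F n in sequentially. 2 * (partition_entropy M (iterated_join M T \<eta> n) + 1) / \<epsilon> / real n < l"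
      by (rule order_tendstoD(2)[OF scaled_entropy_tendsto[OF \<eta>]]) (simp add: l_def)
    then have "\<forall>\<^sub>F n in sequentially. eps_entropy M (average M T n \<rho>) \<epsilon> / ereal (real n) \<le> ereal l"
      using eventually_ge_at_top[of 1]
    proof eventually_elim
      case (elim n)
      have "eps_entropy M (average M T n \<rho>) \<epsilon> / ereal (real n) \<le>
          ereal (2 * (partition_entropy M (iterated_join M T \<eta> n) + 1) / \<epsilon>) / ereal (real n)"
        using elim by (intro ereal_divide_right_mono le) auto
      also have "\<dots> \<le> ereal l" using elim by simp
      finally show ?case .
    qed
    then have "limsup (\<lambda>n. eps_entropy M (average M T n \<rho>) \<epsilon> / ereal (real n)) \<le> ereal l"
      by (rule Limsup_bounded)
    then show "limsup (\<lambda>n. eps_entropy M (average M T n \<rho>) \<epsilon> / ereal (real n)) < \<infinity>"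
      by (rule le_less_trans) simp
  next
    have "0 < liminf (\<lambda>n. eps_entropy M (average M T n \<rho>) \<epsilon> / ereal (real n))"
      if \<epsilon>: "0 < \<epsilon>" "\<epsilon> < \<epsilon>0" for \<epsilon>
    proof -
      have "\<forall>\<^sub>F n in sequentially. ereal c \<le> eps_entropy M (average M T n \<rho>) \<epsilon> / ereal (real n)"
        using growth[OF \<epsilon>(1) less_imp_le[OF \<epsilon>(2)]] eventually_ge_at_top[of 1]
      proof eventually_elim
        case (elim n)
        have "ereal c = ereal (c * real n) / ereal (real n)" using elim(2) by simp
        also have "\<dots> \<le> eps_entropy M (average M T n \<rho>) \<epsilon> / ereal (real n)"
          using elim by (intro ereal_divide_right_mono) auto
        finally show ?case .
      qed
      then have "ereal c \<le> liminf (\<lambda>n. eps_entropy M (average M T n \<rho>) \<epsilon> / ereal (real n))"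
        by (rule Liminf_bounded)
      then show ?thesis using c by (meson ereal_less(2) less_le_trans)
    qed
    then show "\<forall>\<^sub>F \<epsilon> in at_right 0. 0 < liminf (\<lambda>n. eps_entropy M (average M T n \<rho>) \<epsilon> / ereal (real n))"
      using \<epsilon>0 by (auto simp: eventually_at_right_field)
  qed
  then show ?thesis using adm sm gen by (auto simp: scaling_entropy_sequence_def)
qed

text \<open>Forward, at one precision with positive lower limit, \<open>h n\<close> is dominated by
  a multiple of the upper bound, which is sublinear for zero entropy. Backward, positive entropy
  forces linear growth at one precision, where the finite upper limit then makes \<open>h\<close> at
  least linear.\<close>

lemma zero_entropy_iff_smallo:
  assumes "scaling_entropy_sequence M T h"
  shows "ks_entropy M T = 0 \<longleftrightarrow> h \<in> o(\<lambda>n. real n)"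
proof
  obtain \<rho> where adm: "admissible M \<rho>" and sm: "summable_semimetric M \<rho>"
    and gen: "generating M T \<rho>" and sc: "scaling_sequence M T \<rho> h"
    using assms by (auto simp: scaling_entropy_sequence_def)
  have hpos: "0 < h n" if "1 \<le> n" for n using sc that by (simp add: scaling_sequence_def)
  {
    assume zero: "ks_entropy M T = 0"
    have "\<forall>\<^sub>F \<epsilon> in at_right (0 :: real). 0 < \<epsilon> \<and>
        0 < liminf (\<lambda>n. eps_entropy M (average M T n \<rho>) \<epsilon> / ereal (h n))"
      using sc by (intro eventually_conj eventually_at_right_less) (simp add: scaling_sequence_def)
    then obtain \<epsilon> :: real where \<epsilon>: "0 < \<epsilon>"
      and pos: "0 < liminf (\<lambda>n. eps_entropy M (average M T n \<rho>) \<epsilon> / ereal (h n))"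
      using eventually_happens'[OF trivial_limit_at_right_real] by blast
    obtain c where c: "0 < ereal c" "ereal c < liminf (\<lambda>n. eps_entropy M (average M T n \<rho>) \<epsilon> / ereal (h n))"
      using ereal_dense2[OF pos] by blast
    from eps_entropy_average_le[OF adm sm \<epsilon>] obtain \<eta> where \<eta>: "finite_measurable_partition M \<eta>"
      and le: "\<And>n. 1 \<le> n \<Longrightarrow> eps_entropy M (average M T n \<rho>) \<epsilon> \<le>
        ereal (2 * (partition_entropy M (iterated_join M T \<eta> n) + 1) / \<epsilon>)" by this blast
    define u where "u n = 2 * (partition_entropy M (iterated_join M T \<eta> n) + 1) / \<epsilon>" for n
    have "(\<lambda>n. u n / real n) \<longlonglongrightarrow> 0"
      using scaled_entropy_tendsto[OF \<eta>, of \<epsilon>] zero \<eta> by (simp add: ks_entropy_zero_iff u_def)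
    from tendsto_mult[OF tendsto_const[of "1 / c"] this]
    have lim: "(\<lambda>n. 1 / c * (u n / real n)) \<longlonglongrightarrow> 0" by simp
    have cpos: "0 < c" using c(1) by simp
    have upper: "\<forall>\<^sub>F n in sequentially. h n / real n \<le> 1 / c * (u n / real n)"
      using less_LiminfD[OF c(2)] eventually_ge_at_top[of 1]
    proof eventually_elim
      case (elim n)
      have "ereal c < eps_entropy M (average M T n \<rho>) \<epsilon> / ereal (h n)" using elim(1) .
      also have "\<dots> \<le> ereal (u n) / ereal (h n)"
        unfolding u_def using elim hpos[of n] by (intro ereal_divide_right_mono le) auto
      finally have "c < u n / h n" using hpos[OF elim(2)] by simp
      then have "c * h n \<le> u n" using hpos[OF elim(2)] by (simp add: field_simps)
      then have "h n \<le> 1 / c * u n" using cpos by (simp add: field_simps)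
      then have "h n / real n \<le> 1 / c * u n / real n" by (rule divide_right_mono) simp
      then show ?case by simp
    qed
    have "\<forall>\<^sub>F n in sequentially. 0 \<le> h n / real n"
      using eventually_ge_at_top[of 1] by eventually_elim (use hpos in \<open>auto intro: less_imp_le\<close>)
    then have "(\<lambda>n. h n / real n) \<longlonglongrightarrow> 0"
      using upper lim by (rule tendsto_sandwich[OF _ _ tendsto_const])
    then show "h \<in> o(\<lambda>n. real n)"
      by (rule smalloI_tendsto) (use eventually_gt_at_top[of 0] in \<open>auto elim: eventually_mono\<close>)
  }
  assume small: "h \<in> o(\<lambda>n. real n)"
  show "ks_entropy M T = 0"
  proof (rule ccontr)
    assume "ks_entropy M T \<noteq> 0"
    from positive_partition[OF this] obtain \<xi> where
      "finite_measurable_partition M \<xi>" "0 < ks_entropy_partition M T \<xi>" by this blast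
    from linear_entropy_growth[OF adm gen this] obtain \<epsilon> c :: real where \<epsilon>: "0 < \<epsilon>" and c: "0 < c"
      and growth: "\<And>\<epsilon>'. 0 < \<epsilon>' \<Longrightarrow> \<epsilon>' \<le> \<epsilon> \<Longrightarrow>
        \<forall>\<^sub>F n in sequentially. ereal (c * real n) \<le> eps_entropy M (average M T n \<rho>) \<epsilon>'" by this blast
    have "limsup (\<lambda>n. eps_entropy M (average M T n \<rho>) \<epsilon> / ereal (h n)) < \<infinity>"
      using sc \<epsilon> by (simp add: scaling_sequence_def)
    then obtain C where "limsup (\<lambda>n. eps_entropy M (average M T n \<rho>) \<epsilon> / ereal (h n)) < ereal C"
      using ereal_dense2 by blast
    then have ev: "\<forall>\<^sub>F n in sequentially. eps_entropy M (average M T n \<rho>) \<epsilon> / ereal (h n) < ereal C"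
      by (rule Limsup_lessD)
    \<comment> \<open>\<open>C\<close> bounds an upper limit and is not known to be positive;
      \<open>D\<close> is a safe divisor.\<close>
    define D where "D = max 1 C"
    have D: "0 < D" "C \<le> D" by (auto simp: D_def)
    \<comment> \<open>The constant is chosen so that the chain below ends in
      \<open>c * n < c * n / 2\<close>.\<close>
    have "\<forall>\<^sub>F n in sequentially. norm (h n) \<le> c / (2 * D) * norm (real n)"
      using c D by (intro landau_o.smallD[OF small]) auto
    then have "\<forall>\<^sub>F n in sequentially. False"
      using ev growth[OF \<epsilon> order_refl] eventually_ge_at_top[of 1]
    proof eventually_elim
      case (elim n)
      have h: "0 < h n" using hpos elim by simp
      have "ereal (c * real n / h n) = ereal (c * real n) / ereal (h n)" using h by simp
      also have "\<dots> \<le> eps_entropy M (average M T n \<rho>) \<epsilon> / ereal (h n)"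
        using elim h by (intro ereal_divide_right_mono) auto
      also have "\<dots> < ereal C" using elim by simp
      finally have "c * real n / h n < C" by simp
      then have "c * real n < C * h n" using h by (simp add: field_simps)
      also have "\<dots> \<le> D * h n" using D h by (intro mult_right_mono) auto
      also have "\<dots> \<le> D * (c / (2 * D) * real n)" using elim h D by (intro mult_left_mono) auto
      also have "\<dots> = c * real n / 2" using D by simp
      finally show False using c by (simp add: mult_less_0_iff)
    qed
    then show False by simp
  qed
qed

end

theorem theorem2:
  fixes M :: "'a measure" and T :: "'a \<Rightarrow> 'a"
  assumes "standard_probability_space M" and "automorphism M T" and "ergodic M T"
  shows "(0 < ks_entropy M T \<and> ks_entropy M T < \<infinity> \<longrightarrow>
            scaling_entropy_sequence M T (\<lambda>n. real n)) \<and>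
         (\<forall>h. scaling_entropy_sequence M T h \<longrightarrow>
            (ks_entropy M T = 0 \<longleftrightarrow> h \<in> o(\<lambda>n. real n)))"
proof -
  interpret aut_system M T using assms by unfold_locales
  show ?thesis using linear_scaling_entropy_sequence zero_entropy_iff_smallo by auto
qed

end
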